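(* Let $f$ be a hardian germ that is differentially algebraic and generates oscillation, and let $H:=\mathbb R(f,f',f'',\dots)$. Let $\phi>\mathbb R$ be an $H$-hardian germ such that for all $y\in\mathcal C^2$: $y$ is a solution to $Y''+fY=0$ if and only if $y=c(\phi')^{-1/2}\cos(\phi+d)$ for some $c,d\in\mathbb R$. Suppose $\phi$ lies in the smallest Liouville closed Hardy field containing $H$. Then $\phi'=\sqrt h$ for some $h\in H$ with $h>0$.
   Context: $\mathcal C$ is the ring of germs at $+\infty$ of continuous functions $[a,+\infty)\to\mathbb R$, $a\in\mathbb R$; $\mathcal C^n$ is the subring of germs having an $n$-times continuously differentiable representative; $\mathcal C^{<\infty}=\bigcap_n\mathcal C^n$, a differential ring with derivation $g\mapsto g'$. For $g,h\in\mathcal C$, $g<h$ means $g(t)<h(t)$ for all sufficiently large $t$; $\phi>\mathbb R$ means $\phi>c$ for every $c\in\mathbb R$. A germ oscillates if a representative is $0$ at arbitrarily large $t$ and nonzero at arbitrarily large $t$. A solution to $Y''+fY=0$ is a germ $y\in\mathcal C^2$ with $y''+fy=0$; $f$ generates oscillation if some (equivalently, every) nonzero solution oscillates. A Hardy field is a subfield of $\mathcal C^{<\infty}$ closed under $g\mapsto g'$. A germ is hardian if it lies in a Hardy field, and $H$-hardian if it lies in a Hardy field extending $H$. For hardian $f$, $\mathbb R(f,f',f'',\dots)$ is a Hardy field. A Hardy field $L\supseteq\mathbb R$ is Liouville closed if it is real closed, closed under exponentiation, and contains for each $h\in L$ some $g\in\mathcal C^1$ with $g'=h$; every Hardy field containing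 $\mathbb R$ has a smallest Liouville closed Hardy field extension. Differentially algebraic means differentially algebraic over $\mathbb Q$: $P(f,f',\dots,f^{(m)})=0$ for some $m$ and nonzero $P\in\mathbb Q[Y_0,\dots,Y_m]$. *)

theory Defs
  imports "HOL-Analysis.Analysis" "HOL-Computational_Algebra.Polynomial" "HOL-Library.Poly_Mapping"
begin

text \<open>
  The type \<open>germ\<close> consists of the germs at \<open>+\<infinity>\<close> of arbitrary functions; the ring of germs of
  continuous functions is its subset \<open>Cn 0\<close> (see below).
\<close>

quotient_type germ = "real \<Rightarrow> real" / "\<lambda>f g. \<forall>\<^sub>F t in at_top. f t = g t"
  morphisms rep_germ germ_of
proof (rule equivpI)
  show "reflp (\<lambda>f g :: real \<Rightarrow> real. \<forall>\<^sub>F t in at_top. f t = g t)"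
    by (simp add: reflp_def)
  show "symp (\<lambda>f g :: real \<Rightarrow> real. \<forall>\<^sub>F t in at_top. f t = g t)"
    by (simp add: symp_def eq_commute)
  show "transp (\<lambda>f g :: real \<Rightarrow> real. \<forall>\<^sub>F t in at_top. f t = g t)"
    by (rule transpI) (auto elim: eventually_elim2)
qed

instantiation germ :: comm_ring_1
begin

lift_definition zero_germ :: germ is "\<lambda>_. 0" .
lift_definition one_germ :: germ is "\<lambda>_. 1" .
lift_definition plus_germ :: "germ \<Rightarrow> germ \<Rightarrow> germ" is "\<lambda>f g t. f t + g t"
  by (auto elim: eventually_elim2)
lift_definition minus_germ :: "germ \<Rightarrow> germ \<Rightarrow> germ" is "\<lambda>f g t. f t - g t"
  by (auto elim: eventually_elim2)
lift_definition uminus_germ :: "germ \<Rightarrow> germ" is "\<lambda>f t. - f t"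
  by (auto elim: eventually_mono)
lift_definition times_germ :: "germ \<Rightarrow> germ \<Rightarrow> germ" is "\<lambda>f g t. f t * g t"
  by (auto elim: eventually_elim2)

instance
  by standard (transfer; simp add: algebra_simps)+

end

instantiation germ :: real_algebra_1
begin

lift_definition scaleR_germ :: "real \<Rightarrow> germ \<Rightarrow> germ" is "\<lambda>c f t. c * f t"
  by (auto elim: eventually_mono)

instance
  by standard (transfer; simp add: algebra_simps)+

end

text \<open>Thus \<open>of_real c\<close> is the germ of the constant function \<open>c\<close>, and \<open>\<real>\<close> is the set of these germs.\<close>

lemma of_real_germ: "of_real c = germ_of (\<lambda>_. c)"
  unfolding of_real_def by transfer simp

text \<open>
  Both relations are to hold eventually. Beware that \<open><\<close> is not the strict part of \<open>\<le>\<close>, so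
  there is no instance of class \<open>preorder\<close>.
\<close>

instantiation germ :: ord
begin

lift_definition less_eq_germ :: "germ \<Rightarrow> germ \<Rightarrow> bool" is "\<lambda>f g. \<forall>\<^sub>F t in at_top. f t \<le> g t"
proof -
  fix f1 f2 g1 g2 :: "real \<Rightarrow> real"
  assume "\<forall>\<^sub>F t in at_top. f1 t = f2 t" "\<forall>\<^sub>F t in at_top. g1 t = g2 t"
  then have "\<forall>\<^sub>F t in at_top. (f1 t \<le> g1 t) = (f2 t \<le> g2 t)"
    by (auto elim: eventually_elim2)
  then show "(\<forall>\<^sub>F t in at_top. f1 t \<le> g1 t) = (\<forall>\<^sub>F t in at_top. f2 t \<le> g2 t)"
    by (rule eventually_subst)
qed
lift_definition less_germ :: "germ \<Rightarrow> germ \<Rightarrow> bool" is "\<lambda>f g. \<forall>\<^sub>F t in at_top. f t < g t"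
proof -
  fix f1 f2 g1 g2 :: "real \<Rightarrow> real"
  assume "\<forall>\<^sub>F t in at_top. f1 t = f2 t" "\<forall>\<^sub>F t in at_top. g1 t = g2 t"
  then have "\<forall>\<^sub>F t in at_top. (f1 t < g1 t) = (f2 t < g2 t)"
    by (auto elim: eventually_elim2)
  then show "(\<forall>\<^sub>F t in at_top. f1 t < g1 t) = (\<forall>\<^sub>F t in at_top. f2 t < g2 t)"
    by (rule eventually_subst)
qed

instance ..

end

lift_definition germ_comp :: "(real \<Rightarrow> real) \<Rightarrow> germ \<Rightarrow> germ" is "\<lambda>u f t. u (f t)"
  by (auto elim: eventually_mono)

text \<open>
  The derivation is total here because \<^const>\<open>deriv\<close> is; it is only meaningful on
  the germs in \<open>Cn 1\<close>.
\<close>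

lift_definition germ_deriv :: "germ \<Rightarrow> germ" is deriv
proof -
  fix f g :: "real \<Rightarrow> real"
  assume "\<forall>\<^sub>F t in at_top. f t = g t"
  then obtain a where a: "f t = g t" if "t \<ge> a" for t
    by (auto simp: eventually_at_top_linorder)
  have "deriv f t = deriv g t" if "t > a" for t
    by (rule deriv_cong_ev)
       (use that a in \<open>auto intro!: eventually_mono[OF eventually_nhds_in_open[of "{a<..}" t]]\<close>)
  then show "\<forall>\<^sub>F t in at_top. deriv f t = deriv g t"
    by (rule eventually_mono[OF eventually_gt_at_top])
qed

text \<open>
  Germs with an \<open>n\<close> times continuously differentiable representative on some \<open>[a, \<infinity>)\<close>;
  \<open>F k\<close> is the \<open>k\<close>-th derivative of this representative, one-sided at \<open>a\<close>.
\<close>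

definition Cn :: "nat \<Rightarrow> germ set" where
  "Cn n = {germ_of (F 0) | F. \<exists>a.
     (\<forall>k<n. \<forall>t\<ge>a. (F k has_real_derivative F (Suc k) t) (at t within {a..})) \<and>
     continuous_on {a..} (F n)}"

definition C_less_infty :: "germ set" where
  "C_less_infty = (\<Inter>n. Cn n)"

definition germ_subfield :: "germ set \<Rightarrow> bool" where
  "germ_subfield K \<longleftrightarrow> 0 \<in> K \<and> 1 \<in> K \<and>
     (\<forall>g\<in>K. \<forall>h\<in>K. g + h \<in> K \<and> g - h \<in> K \<and> g * h \<in> K) \<and>
     (\<forall>g\<in>K. g \<noteq> 0 \<longrightarrow> (\<exists>h\<in>K. g * h = 1))"

definition Hardy_field :: "germ set \<Rightarrow> bool" where
  "Hardy_field K \<longleftrightarrow> K \<subseteq> C_less_infty \<and> germ_subfield K \<and> (\<forall>g\<in>K. germ_deriv g \<in> K)"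

definition hardian :: "germ \<Rightarrow> bool" where
  "hardian g \<longleftrightarrow> (\<exists>K. Hardy_field K \<and> g \<in> K)"

definition hardian_over :: "germ set \<Rightarrow> germ \<Rightarrow> bool" where
  "hardian_over H g \<longleftrightarrow> (\<exists>K. Hardy_field K \<and> H \<subseteq> K \<and> g \<in> K)"

text \<open>
  The field \<open>\<real>(f, f', f'', \<dots>)\<close>. This is intended for hardian \<open>f\<close>; in general
  there need not be a subfield containing these germs, and then the hull is \<open>UNIV\<close>.
\<close>

definition real_diff_field :: "germ \<Rightarrow> germ set" where
  "real_diff_field f = germ_subfield hull (\<real> \<union> range (\<lambda>n. (germ_deriv ^^ n) f))"

text \<open>
  Real closedness, for subfields on which \<open><\<close> is a total ordering (such as Hardy fields).
\<close>

definition real_closed :: "germ set \<Rightarrow> bool" where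
  "real_closed K \<longleftrightarrow>
     (\<forall>g\<in>K. g > 0 \<longrightarrow> (\<exists>h\<in>K. h ^ 2 = g)) \<and>
     (\<forall>p. (\<forall>i. coeff p i \<in> K) \<and> odd (degree p) \<longrightarrow> (\<exists>g\<in>K. poly p g = 0))"

definition Liouville_closed :: "germ set \<Rightarrow> bool" where
  "Liouville_closed L \<longleftrightarrow> Hardy_field L \<and> \<real> \<subseteq> L \<and> real_closed L \<and>
     (\<forall>h\<in>L. germ_comp exp h \<in> L) \<and>
     (\<forall>h\<in>L. \<exists>g\<in>L. g \<in> Cn 1 \<and> germ_deriv g = h)"

definition smallest_Liouville_closed_ext :: "germ set \<Rightarrow> germ set \<Rightarrow> bool" where
  "smallest_Liouville_closed_ext H L \<longleftrightarrow> Liouville_closed L \<and> H \<subseteq> L \<and>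
     (\<forall>M. Liouville_closed M \<and> H \<subseteq> M \<longrightarrow> L \<subseteq> M)"

lift_definition oscillates :: "germ \<Rightarrow> bool" is
  "\<lambda>f. (\<exists>\<^sub>F t in at_top. f t = 0) \<and> (\<exists>\<^sub>F t in at_top. f t \<noteq> 0)"
proof -
  fix f g :: "real \<Rightarrow> real"
  assume "\<forall>\<^sub>F t in at_top. f t = g t"
  then have *: "\<forall>\<^sub>F t in at_top. (f t = 0) = (g t = 0)" "\<forall>\<^sub>F t in at_top. (f t \<noteq> 0) = (g t \<noteq> 0)"
    by (auto elim: eventually_mono)
  show "((\<exists>\<^sub>F t in at_top. f t = 0) \<and> (\<exists>\<^sub>F t in at_top. f t \<noteq> 0)) =
        ((\<exists>\<^sub>F t in at_top. g t = 0) \<and> (\<exists>\<^sub>F t in at_top. g t \<noteq> 0))"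
    using eventually_subst[OF *(1)] eventually_subst[OF *(2)] by (simp add: frequently_def)
qed

definition solution :: "germ \<Rightarrow> germ \<Rightarrow> bool" where
  "solution f y \<longleftrightarrow> y \<in> Cn 2 \<and> germ_deriv (germ_deriv y) + f * y = 0"

definition generates_oscillation :: "germ \<Rightarrow> bool" where
  "generates_oscillation f \<longleftrightarrow> (\<exists>y. solution f y \<and> y \<noteq> 0 \<and> oscillates y)"

text \<open>
  A polynomial over \<open>\<rat>\<close> in \<open>Y\<^sub>0, Y\<^sub>1, \<dots>\<close> maps monomials, i.e. finitely supported exponent
  functions, to coefficients. We substitute \<open>v i\<close> for \<open>Y\<^sub>i\<close>.
\<close>

definition mpoly_vars :: "((nat \<Rightarrow>\<^sub>0 nat) \<Rightarrow>\<^sub>0 rat) \<Rightarrow> nat set" where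
  "mpoly_vars P = (\<Union>m\<in>Poly_Mapping.keys P. Poly_Mapping.keys m)"

definition mpoly_eval :: "((nat \<Rightarrow>\<^sub>0 nat) \<Rightarrow>\<^sub>0 rat) \<Rightarrow> (nat \<Rightarrow> germ) \<Rightarrow> germ" where
  "mpoly_eval P v = (\<Sum>m\<in>Poly_Mapping.keys P. of_real (of_rat (Poly_Mapping.lookup P m)) *
     (\<Prod>i\<in>Poly_Mapping.keys m. v i ^ Poly_Mapping.lookup m i))"

definition differentially_algebraic :: "germ \<Rightarrow> bool" where
  "differentially_algebraic f \<longleftrightarrow> (\<exists>m P. P \<noteq> 0 \<and> mpoly_vars P \<subseteq> {..m} \<and>
     mpoly_eval P (\<lambda>i. (germ_deriv ^^ i) f) = 0)"

end

theory Submission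
  imports Defs
begin

text \<open>
  Write \<open>p = \<phi>'\<close> and \<open>w = 1/p\<close>. That \<open>p\<^sup>-\<^sup>1\<^sup>/\<^sup>2 cos \<phi>\<close> and \<open>p\<^sup>-\<^sup>1\<^sup>/\<^sup>2 sin \<phi>\<close> solve \<open>Y'' + fY = 0\<close> amounts to
  the equation \<open>2ww'' - w'\<^sup>2 + 4fw\<^sup>2 = 4\<close> (\<open>pinney_of_solutions\<close>). Differentiating it shows that \<open>w\<close>
  is a solution to \<open>Y''' + 4fY' + 2f'Y = 0\<close>, the symmetric square of \<open>Y'' + fY = 0\<close>, whose solution
  space is spanned by \<open>w\<close>, \<open>w cos 2\<phi>\<close> and \<open>w sin 2\<phi>\<close>. A germ in the Hardy field \<open>L\<close> which is a
  periodic function of \<open>\<phi>\<close> must be constant, since it takes one of its values at arbitrarily large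
  arguments (\<open>periodic_germ_constant\<close>). So the solutions in \<open>L\<close> are the real multiples of \<open>w\<close>, and
  \<open>w\<^sup>2\<close> is the only nonzero solution in \<open>L\<close> of an algebraic differential equation over \<open>H\<close>
  (\<open>square_unique\<close>). Galois theory suggests that an element of \<open>L\<close> that is determined in this way
  cannot require any extension of \<open>H\<close>: that is, \<open>w\<^sup>2 \<in> H\<close>, and then \<open>h = 1/w\<^sup>2\<close> has the required
  property.

  To carry this out without a tower of extensions, suppose that \<open>w\<^sup>2 \<notin> H\<close> and take a
  maximal Hardy field \<open>F\<close> with \<open>H \<subseteq> F \<subseteq> L\<close> and \<open>w\<^sup>2 \<notin> F\<close>. Then \<open>F\<close> is Liouville closed, which
  forces \<open>L = F\<close>, a contradiction. Indeed, let \<open>t \<in> L\<close> be a germ that \<open>F\<close> might lack: one algebraic over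
  \<open>F\<close>, an integral of an element of \<open>F\<close>, or the exponential of one. If \<open>t \<notin> F\<close>, then \<open>w\<^sup>2 \<in> F(t)\<close>
  by maximality, and it remains to derive \<open>w\<^sup>2 \<in> F\<close>.

  If \<open>t\<close> is transcendental over \<open>F\<close>, then the substitutions \<open>t \<mapsto> t + c\<close> (integrals) or \<open>t \<mapsto> ct\<close>
  (exponentials) with real \<open>c\<close> commute with the derivation. They send \<open>w\<^sup>2\<close> to a solution of
  the same equation, that is, to \<open>w\<^sup>2\<close>; and a rational function invariant under all of them is
  constant (\<open>square_mem_of_substitution\<close>).

  If \<open>t\<close> is algebraic over \<open>F\<close>, then so is \<open>w\<close>, and traces replace conjugates
  (\<open>square_mem_of_algebraic\<close>). Multiplication by \<open>w\<close> on \<open>F(w)\<close> is given by a matrix \<open>M\<close> over \<open>F\<close>, and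
  the derivation of \<open>F(w)\<close> induces a derivation \<open>\<nabla>\<close> on matrices, for which \<open>M\<close> is a solution of
  the symmetric square. Hence \<open>M\<close> is a combination of \<open>w\<close>, \<open>w cos 2\<phi>\<close> and \<open>w sin 2\<phi>\<close> with coefficients that
  \<open>\<nabla>\<close> annihilates, so the trace of \<open>M\<^sup>k\<close> is \<open>w\<^sup>k\<close> times a periodic function of \<open>\<phi>\<close>. This trace lies in
  \<open>F\<close>, so that periodic function is a constant \<open>c\<^sub>k\<close>. Some \<open>c\<^sub>k\<close> with \<open>k > 0\<close> is nonzero; then
  \<open>w\<^sup>k \<in> F\<close>, so \<open>w'/w \<in> F\<close>, and the equation for \<open>w\<close> expresses \<open>w\<^sup>2\<close> in terms of \<open>w'/w\<close> and \<open>f\<close>.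
\<close>

section \<open>Differentiable and smooth germs\<close>

notation germ_deriv ("\<partial>")

lift_definition differentiable_germ :: "germ \<Rightarrow> bool" is
  "\<lambda>f. \<forall>\<^sub>F t in at_top. f field_differentiable (at t)"
proof -
  fix f g :: "real \<Rightarrow> real"
  assume "\<forall>\<^sub>F t in at_top. f t = g t"
  then obtain a where a: "f t = g t" if "t \<ge> a" for t
    by (auto simp: eventually_at_top_linorder)
  have "(f field_differentiable (at t)) = (g field_differentiable (at t))" if "t > a" for t
  proof -
    have *: "eventually (\<lambda>x. f x = g x) (nhds t)"
      by (rule eventually_mono[OF eventually_nhds_in_open[of "{a<..}" t]]) (use that a in auto)
    show ?thesis
      unfolding field_differentiable_def using DERIV_cong_ev[OF refl * refl] by simp
  qed
  then have "\<forall>\<^sub>F t in at_top. (f field_differentiable (at t)) = (g field_differentiable (at t))"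
    by (rule eventually_mono[OF eventually_gt_at_top])
  then show "(\<forall>\<^sub>F t in at_top. f field_differentiable (at t)) =
      (\<forall>\<^sub>F t in at_top. g field_differentiable (at t))"
    by (rule eventually_subst)
qed

lemma germ_deriv_add:
  assumes "differentiable_germ g" "differentiable_germ h"
  shows "differentiable_germ (g + h)" "\<partial> (g + h) = \<partial> g + \<partial> h"
proof -
  show "differentiable_germ (g + h)"
    using assms by transfer (rule eventually_elim2, assumption+, intro field_differentiable_add)
  show "\<partial> (g + h) = \<partial> g + \<partial> h"
    using assms by transfer (rule eventually_elim2, assumption+, rule deriv_add)
qed

lemma germ_deriv_diff:
  assumes "differentiable_germ g" "differentiable_germ h"
  shows "differentiable_germ (g - h)" "\<partial> (g - h) = \<partial> g - \<partial> h"
proof -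
  show "differentiable_germ (g - h)"
    using assms by transfer (rule eventually_elim2, assumption+, intro field_differentiable_diff)
  show "\<partial> (g - h) = \<partial> g - \<partial> h"
    using assms by transfer (rule eventually_elim2, assumption+, rule deriv_diff)
qed

lemma germ_deriv_mult:
  assumes "differentiable_germ g" "differentiable_germ h"
  shows "differentiable_germ (g * h)" "\<partial> (g * h) = \<partial> g * h + g * \<partial> h"
proof -
  show "differentiable_germ (g * h)"
    using assms by transfer (rule eventually_elim2, assumption+, intro field_differentiable_mult)
  show "\<partial> (g * h) = \<partial> g * h + g * \<partial> h"
    using assms by transfer (rule eventually_elim2, assumption+, simp add: deriv_mult)
qed

lemma germ_deriv_of_real [simp]: "differentiable_germ (of_real c)" "\<partial> (of_real c) = 0"
  unfolding of_real_germ by (transfer, simp)+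

lemma has_field_derivative_imp_differentiable:
  "(f has_field_derivative f') F \<Longrightarrow> f field_differentiable F"
  unfolding field_differentiable_def by blast

lemma germ_deriv_cos:
  assumes "differentiable_germ g"
  shows "differentiable_germ (germ_comp cos g)" "\<partial> (germ_comp cos g) = - germ_comp sin g * \<partial> g"
proof -
  have *: "((\<lambda>t. cos (f t)) has_field_derivative (- sin (f t) * deriv f t)) (at t)"
    if "f field_differentiable (at t)" for f :: "real \<Rightarrow> real" and t
    using that unfolding DERIV_deriv_iff_field_differentiable[symmetric]
    by (auto intro!: derivative_eq_intros)
  show "differentiable_germ (germ_comp cos g)"
    using assms by transfer (auto elim!: eventually_mono intro: *[THEN has_field_derivative_imp_differentiable])
  show "\<partial> (germ_comp cos g) = - germ_comp sin g * \<partial> g"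
    using assms by transfer (auto elim!: eventually_mono simp: *[THEN DERIV_imp_deriv])
qed

lemma germ_deriv_sin:
  assumes "differentiable_germ g"
  shows "differentiable_germ (germ_comp sin g)" "\<partial> (germ_comp sin g) = germ_comp cos g * \<partial> g"
proof -
  have *: "((\<lambda>t. sin (f t)) has_field_derivative (cos (f t) * deriv f t)) (at t)"
    if "f field_differentiable (at t)" for f :: "real \<Rightarrow> real" and t
    using that unfolding DERIV_deriv_iff_field_differentiable[symmetric]
    by (auto intro!: derivative_eq_intros)
  show "differentiable_germ (germ_comp sin g)"
    using assms by transfer (auto elim!: eventually_mono intro: *[THEN has_field_derivative_imp_differentiable])
  show "\<partial> (germ_comp sin g) = germ_comp cos g * \<partial> g"
    using assms by transfer (auto elim!: eventually_mono simp: *[THEN DERIV_imp_deriv])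
qed

lemma germ_deriv_exp:
  assumes "differentiable_germ g"
  shows "\<partial> (germ_comp exp g) = germ_comp exp g * \<partial> g"
proof -
  have *: "((\<lambda>t. exp (f t)) has_field_derivative (exp (f t) * deriv f t)) (at t)"
    if "f field_differentiable (at t)" for f :: "real \<Rightarrow> real" and t
    using that unfolding DERIV_deriv_iff_field_differentiable[symmetric]
    by (auto intro!: derivative_eq_intros)
  show ?thesis
    using assms by transfer (auto elim!: eventually_mono simp: *[THEN DERIV_imp_deriv])
qed

lemma germ_of_surj: obtains f where "g = germ_of f"
  using Quotient_abs_rep[OF Quotient_germ, of g] by metis

lemma Cn_0_iff: "germ_of f \<in> Cn 0 \<longleftrightarrow> (\<exists>a. continuous_on {a..} f)"
proof
  assume "germ_of f \<in> Cn 0"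
  then obtain F a where F: "germ_of f = germ_of (F 0)" "continuous_on {a..} (F 0)"
    unfolding Cn_def by auto
  then obtain b where b: "f t = F 0 t" if "t \<ge> b" for t
    unfolding germ.abs_eq_iff eventually_at_top_linorder by auto
  have "continuous_on {max a b..} (F 0)"
    using F(2) by (rule continuous_on_subset) auto
  then have "continuous_on {max a b..} f"
    by (subst continuous_on_cong[OF refl, of _ f "F 0"]) (use b in auto)
  then show "\<exists>a. continuous_on {a..} f" ..
next
  assume "\<exists>a. continuous_on {a..} f"
  then show "germ_of f \<in> Cn 0"
    unfolding Cn_def by (auto intro!: exI[of _ "\<lambda>_. f"])
qed

text \<open>
  With this recursion, closure properties of \<open>Cn n\<close> follow by induction on \<open>n\<close> from the
  differentiation rules. For the converse direction the derivatives that \<open>Cn n\<close> provides for \<open>\<partial> g\<close>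
  are shifted by one and restricted to an interval on which \<open>g\<close> is differentiable too.
\<close>
lemma Cn_Suc_iff: "g \<in> Cn (Suc n) \<longleftrightarrow> differentiable_germ g \<and> \<partial> g \<in> Cn n"
proof
  assume "g \<in> Cn (Suc n)"
  then obtain F a where F: "g = germ_of (F 0)"
      "\<And>k t. k < Suc n \<Longrightarrow> t \<ge> a \<Longrightarrow> (F k has_real_derivative F (Suc k) t) (at t within {a..})"
      "continuous_on {a..} (F (Suc n))"
    unfolding Cn_def by auto
  have d: "(F 0 has_real_derivative F 1 t) (at t)" if "t > a" for t
  proof -
    have "at t within {a..} = at t"
      by (rule at_within_interior) (use that in auto)
    then show ?thesis using F(2)[of 0 t] that by simp
  qed
  have "differentiable_germ g"
    unfolding F(1) differentiable_germ.abs_eq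
    by (rule eventually_mono[OF eventually_gt_at_top[of a]]) (auto dest!: d simp: field_differentiable_def)
  moreover have "\<partial> g = germ_of (F 1)"
    unfolding F(1) germ_deriv.abs_eq germ.abs_eq_iff
    by (rule eventually_mono[OF eventually_gt_at_top[of a]]) (auto dest!: d intro: DERIV_imp_deriv)
  moreover have "germ_of (F 1) \<in> Cn n"
    unfolding Cn_def using F(2,3) by (auto intro!: exI[of _ "\<lambda>k. F (Suc k)"] exI[of _ a])
  ultimately show "differentiable_germ g \<and> \<partial> g \<in> Cn n" by simp
next
  assume *: "differentiable_germ g \<and> \<partial> g \<in> Cn n"
  obtain f where f: "g = germ_of f" by (rule germ_of_surj)
  from * obtain G a where G: "\<partial> g = germ_of (G 0)"
      "\<And>k t. k < n \<Longrightarrow> t \<ge> a \<Longrightarrow> (G k has_real_derivative G (Suc k) t) (at t within {a..})"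
      "continuous_on {a..} (G n)"
    unfolding Cn_def by auto
  have "\<forall>\<^sub>F t in at_top. f field_differentiable (at t) \<and> deriv f t = G 0 t"
    using * G(1) unfolding f germ_deriv.abs_eq germ.abs_eq_iff differentiable_germ.abs_eq
    by (auto elim: eventually_elim2)
  then obtain b where b: "f field_differentiable (at t)" "deriv f t = G 0 t" if "t \<ge> b" for t
    unfolding eventually_at_top_linorder by auto
  define c where "c = max a b"
  define F where "F k = (case k of 0 \<Rightarrow> f | Suc k \<Rightarrow> G k)" for k
  have "(F k has_real_derivative F (Suc k) t) (at t within {c..})" if "k < Suc n" "t \<ge> c" for k t
  proof (cases k)
    case 0
    have "(f has_real_derivative deriv f t) (at t)"
      using b(1)[of t] that by (simp add: c_def DERIV_deriv_iff_field_differentiable)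
    then show ?thesis
      using b(2)[of t] that by (auto simp: F_def 0 c_def intro: has_field_derivative_at_within)
  next
    case (Suc j)
    then show ?thesis
      using G(2)[of j t] that by (auto simp: F_def c_def intro: DERIV_subset)
  qed
  moreover have "continuous_on {c..} (F (Suc n))"
    using G(3) by (auto simp: F_def c_def intro: continuous_on_subset)
  moreover have "g = germ_of (F 0)" by (simp add: f F_def)
  ultimately show "g \<in> Cn (Suc n)" unfolding Cn_def by blast
qed

lemma Cn_decreasing: "Cn (Suc n) \<subseteq> Cn n"
proof (induction n)
  case 0
  show ?case
  proof
    fix g assume "g \<in> Cn (Suc 0)"
    then have d: "differentiable_germ g" by (simp add: Cn_Suc_iff)
    obtain f where f: "g = germ_of f" by (rule germ_of_surj)
    from d obtain a where "\<And>t. t \<ge> a \<Longrightarrow> f field_differentiable (at t)"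
      unfolding f differentiable_germ.abs_eq eventually_at_top_linorder by auto
    then have "continuous_on {a..} f"
      by (intro continuous_at_imp_continuous_on) (auto intro: field_differentiable_imp_continuous_at)
    then show "g \<in> Cn 0" unfolding f Cn_0_iff by auto
  qed
next
  case (Suc n)
  show ?case
  proof
    fix g assume "g \<in> Cn (Suc (Suc n))"
    then have "differentiable_germ g" "\<partial> g \<in> Cn (Suc n)"
      by (simp_all only: Cn_Suc_iff[of g "Suc n"])
    with Suc show "g \<in> Cn (Suc n)" by (auto simp only: Cn_Suc_iff[of g n])
  qed
qed

lemma Cn_add: "g \<in> Cn n \<Longrightarrow> h \<in> Cn n \<Longrightarrow> g + h \<in> Cn n"
proof (induction n arbitrary: g h)
  case 0
  obtain f1 where f1: "g = germ_of f1" by (rule germ_of_surj)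
  obtain f2 where f2: "h = germ_of f2" by (rule germ_of_surj)
  note f = f1 f2
  obtain a b where "continuous_on {a..} f1" "continuous_on {b..} f2"
    using 0 unfolding f Cn_0_iff by auto
  then have "continuous_on {max a b..} f1" "continuous_on {max a b..} f2"
    by (auto intro: continuous_on_subset[of "{a..}" f1] continuous_on_subset[of "{b..}" f2])
  then have "continuous_on {max a b..} (\<lambda>t. f1 t + f2 t)" by (intro continuous_intros)
  then show ?case unfolding f plus_germ.abs_eq Cn_0_iff by blast
qed (auto simp: Cn_Suc_iff germ_deriv_add)

lemma Cn_mult: "g \<in> Cn n \<Longrightarrow> h \<in> Cn n \<Longrightarrow> g * h \<in> Cn n"
proof (induction n arbitrary: g h)
  case 0
  obtain f1 where f1: "g = germ_of f1" by (rule germ_of_surj)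
  obtain f2 where f2: "h = germ_of f2" by (rule germ_of_surj)
  note f = f1 f2
  obtain a b where "continuous_on {a..} f1" "continuous_on {b..} f2"
    using 0 unfolding f Cn_0_iff by auto
  then have "continuous_on {max a b..} f1" "continuous_on {max a b..} f2"
    by (auto intro: continuous_on_subset[of "{a..}" f1] continuous_on_subset[of "{b..}" f2])
  then have "continuous_on {max a b..} (\<lambda>t. f1 t * f2 t)" by (intro continuous_intros)
  then show ?case unfolding f times_germ.abs_eq Cn_0_iff by blast
next
  case (Suc n)
  then have "g \<in> Cn n" "h \<in> Cn n" using Cn_decreasing by blast+
  then show ?case
    using Suc.prems by (auto simp: Cn_Suc_iff germ_deriv_mult intro!: Cn_add Suc.IH)
qed

lemma Cn_of_real [simp]: "of_real c \<in> Cn n"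
proof (induction n arbitrary: c)
  case 0
  show ?case unfolding of_real_germ Cn_0_iff by (auto intro!: exI[of _ 0] continuous_on_const)
next
  case (Suc n)
  show ?case using Suc[of 0] by (simp add: Cn_Suc_iff)
qed

lemma smooth_differentiable: "g \<in> C_less_infty \<Longrightarrow> differentiable_germ g"
  using Cn_Suc_iff[of g 0] unfolding C_less_infty_def by blast

lemma smooth_deriv: "g \<in> C_less_infty \<Longrightarrow> \<partial> g \<in> C_less_infty"
  using Cn_Suc_iff[of g] unfolding C_less_infty_def by blast

lemma smooth_of_real [simp]: "of_real c \<in> C_less_infty"
  by (simp add: C_less_infty_def)

lemma smooth_0 [simp]: "0 \<in> C_less_infty" and smooth_1 [simp]: "1 \<in> C_less_infty"
  using smooth_of_real[of 0] smooth_of_real[of 1] by simp_all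

lemma smooth_add: "g \<in> C_less_infty \<Longrightarrow> h \<in> C_less_infty \<Longrightarrow> g + h \<in> C_less_infty"
  by (simp add: C_less_infty_def Cn_add)

lemma smooth_mult: "g \<in> C_less_infty \<Longrightarrow> h \<in> C_less_infty \<Longrightarrow> g * h \<in> C_less_infty"
  by (simp add: C_less_infty_def Cn_mult)

lemma smooth_uminus: "g \<in> C_less_infty \<Longrightarrow> - g \<in> C_less_infty"
  using smooth_mult[OF smooth_of_real[of "-1"], of g] by simp

lemma smooth_diff: "g \<in> C_less_infty \<Longrightarrow> h \<in> C_less_infty \<Longrightarrow> g - h \<in> C_less_infty"
  using smooth_add[OF _ smooth_uminus, of g h] by simp

lemma smooth_sum: "(\<And>i. i \<in> I \<Longrightarrow> g i \<in> C_less_infty) \<Longrightarrow> sum g I \<in> C_less_infty"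
  by (induction I rule: infinite_finite_induct) (auto intro: smooth_add)

lemma smooth_power: "g \<in> C_less_infty \<Longrightarrow> g ^ k \<in> C_less_infty"
  by (induction k) (auto intro: smooth_mult)

lemma smooth_numeral [simp]: "numeral k \<in> C_less_infty"
  using smooth_of_real[of "numeral k"] by simp

lemma smooth_cos_sin:
  assumes "g \<in> C_less_infty"
  shows "germ_comp cos g \<in> C_less_infty" "germ_comp sin g \<in> C_less_infty"
proof -
  have d: "differentiable_germ g" and g: "\<And>n. g \<in> Cn n" and g': "\<And>n. \<partial> g \<in> Cn n"
    using assms smooth_differentiable smooth_deriv[OF assms] by (auto simp: C_less_infty_def)
  have "germ_comp cos g \<in> Cn n \<and> germ_comp sin g \<in> Cn n" for n
  proof (induction n)
    case 0
    obtain f where f: "g = germ_of f" by (rule germ_of_surj)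
    obtain a where "continuous_on {a..} f"
      using g[of 0] unfolding f Cn_0_iff by auto
    then have "continuous_on {a..} (\<lambda>t. cos (f t))" "continuous_on {a..} (\<lambda>t. sin (f t))"
      by (intro continuous_intros; assumption)+
    then show ?case unfolding f germ_comp.abs_eq Cn_0_iff by blast
  next
    case (Suc n)
    have "- germ_comp sin g = of_real (-1) * germ_comp sin g" by simp
    then have "- germ_comp sin g \<in> Cn n" using Suc Cn_mult Cn_of_real by metis
    then show ?case
      using Suc d g' by (auto simp: Cn_Suc_iff germ_deriv_cos germ_deriv_sin intro!: Cn_mult simp del: mult_minus_left)
  qed
  then show "germ_comp cos g \<in> C_less_infty" "germ_comp sin g \<in> C_less_infty"
    by (auto simp: C_less_infty_def)
qed

lemma smooth_deriv_add: "g \<in> C_less_infty \<Longrightarrow> h \<in> C_less_infty \<Longrightarrow> \<partial> (g + h) = \<partial> g + \<partial> h"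
  by (simp add: germ_deriv_add smooth_differentiable)

lemma smooth_deriv_diff: "g \<in> C_less_infty \<Longrightarrow> h \<in> C_less_infty \<Longrightarrow> \<partial> (g - h) = \<partial> g - \<partial> h"
  by (simp add: germ_deriv_diff smooth_differentiable)

lemma smooth_deriv_mult:
  "g \<in> C_less_infty \<Longrightarrow> h \<in> C_less_infty \<Longrightarrow> \<partial> (g * h) = \<partial> g * h + g * \<partial> h"
  by (simp add: germ_deriv_mult smooth_differentiable)

lemma germ_deriv_0 [simp]: "\<partial> 0 = 0" and germ_deriv_1 [simp]: "\<partial> 1 = 0"
  and germ_deriv_numeral [simp]: "\<partial> (numeral k) = 0"
  using germ_deriv_of_real(2)[of 0] germ_deriv_of_real(2)[of 1] germ_deriv_of_real(2)[of "numeral k"]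
  by (simp_all del: germ_deriv_of_real)

lemma smooth_deriv_uminus: "g \<in> C_less_infty \<Longrightarrow> \<partial> (- g) = - \<partial> g"
  using smooth_deriv_diff[of 0 g] by simp

lemma smooth_deriv_sum:
  "(\<And>i. i \<in> I \<Longrightarrow> g i \<in> C_less_infty) \<Longrightarrow> \<partial> (sum g I) = (\<Sum>i\<in>I. \<partial> (g i))"
  by (induction I rule: infinite_finite_induct) (auto simp: smooth_deriv_add smooth_sum)

lemma deriv_zero_constant:
  assumes "differentiable_germ g" "\<partial> g = 0"
  shows "\<exists>c. g = of_real c"
proof -
  obtain f where f: "g = germ_of f" by (rule germ_of_surj)
  have "\<forall>\<^sub>F t in at_top. f field_differentiable (at t) \<and> deriv f t = 0"
    using assms unfolding f by (transfer fixing: f, auto elim: eventually_elim2)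
  then obtain b where b: "f field_differentiable (at t)" "deriv f t = 0" if "t \<ge> b" for t
    unfolding eventually_at_top_linorder by auto
  have "f t = f b" if "t \<ge> b" for t
  proof (cases "t = b")
    case False
    with that have "b < t" by simp
    have d: "(f has_real_derivative 0) (at x)" if "b \<le> x" for x
      using b[OF that] DERIV_deriv_iff_field_differentiable[of f x] by simp
    have "continuous_on {b..t} f"
      using b(1) by (intro continuous_at_imp_continuous_on)
        (auto intro: field_differentiable_imp_continuous_at)
    then show ?thesis
      by (rule DERIV_isconst_end[OF \<open>b < t\<close>]) (rule d, simp)
  qed simp
  then have "g = of_real (f b)"
    unfolding f of_real_germ germ.abs_eq_iff by (intro eventually_at_top_linorderI)
  then show ?thesis ..
qed

section \<open>Fields of germs and Hardy fields\<close>

text \<open>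
  Germs have zero divisors. What makes subfields manageable is that their nonzero elements are units in
  the ring of all germs, so they can be cancelled from any equation.
\<close>
locale germ_field =
  fixes K :: "germ set"
  assumes subfield: "germ_subfield K"
begin

lemma zero_mem [simp]: "0 \<in> K" and one_mem [simp]: "1 \<in> K"
  and add_mem: "x \<in> K \<Longrightarrow> y \<in> K \<Longrightarrow> x + y \<in> K"
  and diff_mem: "x \<in> K \<Longrightarrow> y \<in> K \<Longrightarrow> x - y \<in> K"
  and mult_mem: "x \<in> K \<Longrightarrow> y \<in> K \<Longrightarrow> x * y \<in> K"
  and inverse_mem: "x \<in> K \<Longrightarrow> x \<noteq> 0 \<Longrightarrow> \<exists>y\<in>K. x * y = 1"
  using subfield by (auto simp: germ_subfield_def)

lemma uminus_mem: "x \<in> K \<Longrightarrow> - x \<in> K"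
  using diff_mem[of 0 x] by simp

lemma power_mem: "x \<in> K \<Longrightarrow> x ^ n \<in> K"
  by (induction n) (auto intro: mult_mem)

lemma sum_mem: "(\<And>i. i \<in> I \<Longrightarrow> g i \<in> K) \<Longrightarrow> sum g I \<in> K"
  by (induction I rule: infinite_finite_induct) (auto intro: add_mem)

lemma of_nat_mem: "of_nat n \<in> K"
  by (induction n) (auto intro: add_mem)

lemma numeral_mem [simp]: "numeral n \<in> K"
  using of_nat_mem[of "numeral n"] by simp

lemmas closed = add_mem diff_mem mult_mem uminus_mem power_mem sum_mem of_nat_mem

lemma cancel: "x \<in> K \<Longrightarrow> x \<noteq> 0 \<Longrightarrow> x * y = x * z \<Longrightarrow> y = z"
  by (metis inverse_mem mult.commute mult.left_commute mult_1_right)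

lemma mult_nonzero: "x \<in> K \<Longrightarrow> x \<noteq> 0 \<Longrightarrow> y \<noteq> 0 \<Longrightarrow> x * y \<noteq> 0"
  using cancel[of x y 0] by auto

lemma power_nonzero: "x \<in> K \<Longrightarrow> x \<noteq> 0 \<Longrightarrow> x ^ n \<noteq> 0"
  by (induction n) (use mult_nonzero in auto)

lemma quotient_mem: "x * b = a \<Longrightarrow> a \<in> K \<Longrightarrow> b \<in> K \<Longrightarrow> b \<noteq> 0 \<Longrightarrow> x \<in> K"
proof -
  assume *: "x * b = a" "a \<in> K" "b \<in> K" "b \<noteq> 0"
  then obtain c where c: "c \<in> K" "b * c = 1" using inverse_mem by blast
  have "x = x * b * c" using c(2) by (simp add: mult.assoc)
  then show "x \<in> K" using * c mult_mem by metis
qed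

end

locale hardy_field = germ_field +
  assumes smooth: "K \<subseteq> C_less_infty"
    and deriv_mem: "x \<in> K \<Longrightarrow> \<partial> x \<in> K"
begin

lemma smoothI: "x \<in> K \<Longrightarrow> x \<in> C_less_infty"
  using smooth by blast

lemmas closed_deriv = closed deriv_mem

lemma deriv_add: "x \<in> K \<Longrightarrow> y \<in> K \<Longrightarrow> \<partial> (x + y) = \<partial> x + \<partial> y"
  and deriv_diff: "x \<in> K \<Longrightarrow> y \<in> K \<Longrightarrow> \<partial> (x - y) = \<partial> x - \<partial> y"
  and deriv_mult: "x \<in> K \<Longrightarrow> y \<in> K \<Longrightarrow> \<partial> (x * y) = \<partial> x * y + x * \<partial> y"
  and deriv_sum: "(\<And>i. i \<in> I \<Longrightarrow> g i \<in> K) \<Longrightarrow> \<partial> (sum g I) = (\<Sum>i\<in>I. \<partial> (g i))"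
  by (simp_all add: smoothI smooth_deriv_add smooth_deriv_diff smooth_deriv_mult smooth_deriv_sum)

lemma eventually_nonzero:
  assumes "germ_of g \<in> K" "germ_of g \<noteq> 0"
  shows "\<forall>\<^sub>F t in at_top. g t \<noteq> 0"
proof -
  obtain y where y: "germ_of g * y = 1" using inverse_mem[OF assms] by blast
  obtain h where h: "y = germ_of h" by (rule germ_of_surj)
  have "\<forall>\<^sub>F t in at_top. g t * h t = 1"
    using y unfolding h by (simp add: times_germ.abs_eq one_germ_def germ.abs_eq_iff)
  then show ?thesis by (rule eventually_mono) auto
qed

text \<open>
  A unit has no zeros far out, so the intermediate value theorem fixes the sign of a continuous
  representative.
\<close>
lemma pos_or_neg:
  assumes "x \<in> K" "x \<noteq> 0"
  shows "x > 0 \<or> x < 0"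
proof -
  obtain g where g: "x = germ_of g" by (rule germ_of_surj)
  have "x \<in> Cn 0" using assms(1) smooth by (auto simp: C_less_infty_def)
  then obtain a where a: "continuous_on {a..} g" unfolding g Cn_0_iff by auto
  obtain b where b: "g t \<noteq> 0" if "t \<ge> b" for t
    using eventually_nonzero[of g] assms unfolding g eventually_at_top_linorder by auto
  define c where "c = max a b"
  have cont: "continuous_on {c..t} g" for t
    using a by (rule continuous_on_subset) (auto simp: c_def)
  have nz: "g t \<noteq> 0" if "t \<ge> c" for t using b that by (auto simp: c_def)
  show ?thesis
  proof (cases "g c > 0")
    case True
    have "g t > 0" if "t \<ge> c" for t
      using IVT2'[of g t 0 c] cont[of t] nz that True by force
    then show ?thesis
      unfolding g zero_germ_def less_germ.abs_eq by (intro disjI1 eventually_at_top_linorderI)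
  next
    case False
    with nz[of c] have "g c < 0" by simp
    have "g t < 0" if "t \<ge> c" for t
      using IVT'[of g c 0 t] cont[of t] nz that \<open>g c < 0\<close> by force
    then show ?thesis
      unfolding g zero_germ_def less_germ.abs_eq by (intro disjI2 eventually_at_top_linorderI)
  qed
qed

end

lemma germ_less_irrefl: "\<not> (x < (x :: germ))"
  by transfer simp

lemma germ_neg_pos: "x < (0::germ) \<Longrightarrow> - x > 0"
  by transfer (auto elim: eventually_mono)

lemma hardy_field_iff: "hardy_field K \<longleftrightarrow> Hardy_field K"
  unfolding hardy_field_def germ_field_def hardy_field_axioms_def Hardy_field_def by blast

text \<open>
  The germ \<open>\<phi>\<close> passes through all large multiples of \<open>2\<pi>\<close>, and there \<open>u(\<phi>)\<close> takes the
  value \<open>u(0)\<close>. The difference \<open>u(\<phi>) - u(0)\<close> thus has arbitrarily large zeros, which in a Hardy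
  field is possible only for \<open>0\<close>. It is the point where non-oscillation of
  Hardy field elements enters.
\<close>
lemma periodic_germ_constant:
  assumes "hardy_field K" "\<real> \<subseteq> K" "\<phi> \<in> Cn 0" "\<And>c. of_real c < \<phi>"
    and per: "\<And>x. u (x + 2 * pi) = u x" and mem: "germ_comp u \<phi> \<in> K"
  shows "germ_comp u \<phi> = of_real (u 0)"
proof (rule ccontr)
  interpret hardy_field K by fact
  assume ne: "germ_comp u \<phi> \<noteq> of_real (u 0)"
  obtain g where g: "\<phi> = germ_of g" by (rule germ_of_surj)
  obtain a where a: "continuous_on {a..} g" using assms(3) unfolding g Cn_0_iff by auto
  have eq: "germ_comp u \<phi> - of_real (u 0) = germ_of (\<lambda>t. u (g t) - u 0)"
    by (simp add: g germ_comp.abs_eq of_real_germ minus_germ.abs_eq)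
  have "germ_comp u \<phi> - of_real (u 0) \<in> K"
    using mem assms(2) by (intro diff_mem) auto
  then have "\<forall>\<^sub>F t in at_top. u (g t) - u 0 \<noteq> 0"
    using ne eventually_nonzero[of "\<lambda>t. u (g t) - u 0"] unfolding eq[symmetric] by simp
  then obtain b where b: "u (g t) \<noteq> u 0" if "t \<ge> b" for t
    unfolding eventually_at_top_linorder by auto
  define c where "c = max a b"
  \<comment> \<open>the multiple \<open>2\<pi>k\<close> lies above \<open>g c\<close>, so it is attained after \<open>c\<close>\<close>
  define k where "k = nat \<lceil>g c / (2 * pi)\<rceil>"
  have "g c / (2 * pi) \<le> real k" unfolding k_def by linarith
  then have k: "g c \<le> 2 * pi * real k" by (simp add: field_simps)
  have "\<forall>\<^sub>F t in at_top. 2 * pi * real k < g t"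
    using assms(4)[of "2 * pi * real k"] unfolding g of_real_germ less_germ.abs_eq .
  moreover have "\<forall>\<^sub>F t in at_top. c \<le> t" by (rule eventually_ge_at_top)
  ultimately have "\<forall>\<^sub>F t in at_top. 2 * pi * real k < g t \<and> c \<le> t" by eventually_elim simp
  then obtain d where d: "2 * pi * real k < g d" "c \<le> d"
    using eventually_happens[of _ "at_top :: real filter"] by fastforce
  have "continuous_on {c..d} g" using a by (rule continuous_on_subset) (auto simp: c_def)
  then obtain t where t: "c \<le> t" "g t = 2 * pi * real k"
    using IVT'[of g c "2 * pi * real k" d] k d by auto
  have "u (2 * pi * real n) = u 0" for n
  proof (induction n)
    case (Suc n)
    then show ?case using per[of "2 * pi * real n"] by (simp add: algebra_simps)
  qed simp
  then show False using b[of t] t by (simp add: c_def)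
qed

lemma deriv_pos_of_infinite:
  assumes "hardy_field K" "\<phi> \<in> K" "\<And>c. of_real c < \<phi>"
  shows "\<partial> \<phi> > 0"
proof (rule ccontr)
  interpret hardy_field K by fact
  assume "\<not> \<partial> \<phi> > 0"
  obtain g where g: "\<phi> = germ_of g" by (rule germ_of_surj)
  have "\<partial> \<phi> = 0 \<or> \<partial> \<phi> < 0"
    using pos_or_neg[of "\<partial> \<phi>"] deriv_mem[OF assms(2)] \<open>\<not> \<partial> \<phi> > 0\<close> by blast
  then have "\<forall>\<^sub>F t in at_top. deriv g t \<le> 0"
    unfolding g germ_deriv.abs_eq zero_germ_def less_germ.abs_eq germ.abs_eq_iff
    by (auto elim: eventually_mono)
  moreover have "\<forall>\<^sub>F t in at_top. g field_differentiable (at t)"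
    using smooth_differentiable[OF smoothI[OF assms(2)]] unfolding g differentiable_germ.abs_eq .
  ultimately have "\<forall>\<^sub>F t in at_top. deriv g t \<le> 0 \<and> g field_differentiable (at t)"
    by eventually_elim simp
  then obtain a where a: "deriv g t \<le> 0" "g field_differentiable (at t)" if "t \<ge> a" for t
    unfolding eventually_at_top_linorder by auto
  have mono: "g t \<le> g a" if "t \<ge> a" for t
  proof (rule DERIV_nonpos_imp_nonincreasing[OF that])
    fix x assume "a \<le> x" "x \<le> t"
    then show "\<exists>y. (g has_real_derivative y) (at x) \<and> y \<le> 0"
      using a[of x] DERIV_deriv_iff_field_differentiable[of g x] by blast
  qed
  have "\<forall>\<^sub>F t in at_top. g a < g t"
    using assms(3)[of "g a"] unfolding g of_real_germ less_germ.abs_eq .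
  moreover have "\<forall>\<^sub>F t in at_top. a \<le> t" by (rule eventually_ge_at_top)
  ultimately have "\<forall>\<^sub>F t in at_top. g a < g t \<and> a \<le> t" by eventually_elim simp
  then obtain d where "g a < g d" "a \<le> d"
    using eventually_happens[of _ "at_top :: real filter"] by fastforce
  with mono[of d] show False by simp
qed

section \<open>Simple extensions of Hardy fields\<close>
definition over :: "germ set \<Rightarrow> germ poly \<Rightarrow> bool" where
  "over K p \<longleftrightarrow> (\<forall>i. coeff p i \<in> K)"

definition algebraic_over :: "germ set \<Rightarrow> germ \<Rightarrow> bool" where
  "algebraic_over K t \<longleftrightarrow> (\<exists>p. over K p \<and> p \<noteq> 0 \<and> poly p t = 0)"

definition adjoin :: "germ set \<Rightarrow> germ \<Rightarrow> germ set" where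
  "adjoin K t = {x. \<exists>p q. over K p \<and> over K q \<and> poly q t \<noteq> 0 \<and> x * poly q t = poly p t}"

definition power_basis :: "germ set \<Rightarrow> germ \<Rightarrow> nat \<Rightarrow> (nat \<Rightarrow> germ) \<Rightarrow> bool" where
  "power_basis K t n a \<longleftrightarrow> n > 0 \<and> (\<forall>i. a i \<in> K) \<and> t ^ n = (\<Sum>i<n. a i * t ^ i) \<and>
     (\<forall>c. (\<forall>i. c i \<in> K) \<longrightarrow> (\<Sum>i<n. c i * t ^ i) = 0 \<longrightarrow> (\<forall>i<n. c i = 0))"

text \<open>
  The usual derivative of polynomials; \<open>pderiv\<close> is not applicable because germs have zero divisors.
\<close>
definition formal_deriv :: "germ poly \<Rightarrow> germ poly" where
  "formal_deriv p = (\<Sum>i<degree p. monom (of_nat (Suc i) * coeff p (Suc i)) i)"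

lemma coeff_formal_deriv: "coeff (formal_deriv p) i = of_nat (Suc i) * coeff p (Suc i)"
  unfolding formal_deriv_def by (auto simp: coeff_sum coeff_monom coeff_eq_0 simp del: of_nat_Suc)

lemma formal_deriv_0 [simp]: "formal_deriv 0 = 0"
  by (simp add: formal_deriv_def)

lemma formal_deriv_pCons: "formal_deriv (pCons a p) = p + pCons 0 (formal_deriv p)"
proof (rule poly_eqI)
  fix i
  show "coeff (formal_deriv (pCons a p)) i = coeff (p + pCons 0 (formal_deriv p)) i"
    by (cases i) (simp_all add: coeff_formal_deriv algebra_simps)
qed

lemma over_mono: "over K p \<Longrightarrow> K \<subseteq> L \<Longrightarrow> over L p"
  by (auto simp: over_def)

lemma over_pCons [simp]: "over K (pCons a p) \<longleftrightarrow> a \<in> K \<and> over K p"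
  unfolding over_def by (metis coeff_pCons_0 coeff_pCons_Suc not0_implies_Suc)

context germ_field
begin

lemma over_0 [simp]: "over K 0" and over_1 [simp]: "over K 1"
  by (auto simp: over_def coeff_1)

lemma over_add: "over K p \<Longrightarrow> over K q \<Longrightarrow> over K (p + q)"
  and over_diff: "over K p \<Longrightarrow> over K q \<Longrightarrow> over K (p - q)"
  and over_uminus: "over K p \<Longrightarrow> over K (- p)"
  and over_smult: "a \<in> K \<Longrightarrow> over K p \<Longrightarrow> over K (smult a p)"
  and over_mult: "over K p \<Longrightarrow> over K q \<Longrightarrow> over K (p * q)"
  by (auto simp: over_def coeff_mult intro!: closed)

lemma over_power: "over K p \<Longrightarrow> over K (p ^ n)"
  by (induction n) (auto intro: over_mult)

lemma over_numeral: "over K (numeral n)"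
  using over_pCons[of K "numeral n" 0] by (simp add: numeral_poly)

lemma over_pcompose: "over K p \<Longrightarrow> over K q \<Longrightarrow> over K (pcompose p q)"
  by (induction p) (auto simp: pcompose_pCons intro!: over_add over_mult)

lemmas over_closed = over_add over_diff over_uminus over_smult over_mult over_power over_numeral

lemma over_monom: "a \<in> K \<Longrightarrow> over K (monom a n)"
  by (auto simp: over_def coeff_monom)

lemma over_sum: "(\<And>i. i \<in> I \<Longrightarrow> over K (g i)) \<Longrightarrow> over K (sum g I)"
  by (induction I rule: infinite_finite_induct) (auto intro: over_add)

lemma over_formal_deriv: "over K p \<Longrightarrow> over K (formal_deriv p)"
  unfolding over_def coeff_formal_deriv by (auto intro: closed simp del: of_nat_Suc)

lemma poly_mem: "over K p \<Longrightarrow> t \<in> K \<Longrightarrow> poly p t \<in> K"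
  by (induction p) (auto intro!: closed)

lemma algebraic_overI:
  assumes "\<And>i. c i \<in> K" "k \<le> (n::nat)" "c k \<noteq> 0" "(\<Sum>i\<le>n. c i * t ^ i) = 0"
  shows "algebraic_over K t"
proof -
  define p where "p = (\<Sum>i\<le>n. monom (c i) i)"
  have "over K p" unfolding p_def by (intro over_sum over_monom assms)
  moreover have "coeff p k = c k"
    using assms(2) by (simp add: p_def coeff_sum coeff_monom)
  with assms(3) have "p \<noteq> 0" by auto
  moreover have "poly p t = 0" using assms(4) by (simp add: p_def poly_sum poly_monom)
  ultimately show ?thesis unfolding algebraic_over_def by blast
qed

text \<open>
  Gaussian elimination, with a nonzero entry of the column \<open>j\<close> as the pivot.
\<close>
lemma linear_dependence:
  assumes "finite J" "finite I" "card J < card I" "\<And>i j. i \<in> I \<Longrightarrow> j \<in> J \<Longrightarrow> v i j \<in> K"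
  shows "\<exists>c. (\<forall>i. c i \<in> K) \<and> (\<exists>i\<in>I. c i \<noteq> 0) \<and> (\<forall>j\<in>J. (\<Sum>i\<in>I. c i * v i j) = 0)"
  using assms
proof (induction J arbitrary: I v rule: finite_induct)
  case empty
  then have "I \<noteq> {}" by auto
  then show ?case by (intro exI[of _ "\<lambda>_. 1"]) auto
next
  case (insert j J)
  show ?case
  proof (cases "\<forall>i\<in>I. v i j = 0")
    case True
    obtain c where "\<forall>i. c i \<in> K" "\<exists>i\<in>I. c i \<noteq> 0" "\<forall>j\<in>J. (\<Sum>i\<in>I. c i * v i j) = 0"
      using insert.IH[of I v] insert.prems insert.hyps by auto
    with True show ?thesis by (intro exI[of _ c]) auto
  next
    case False
    then obtain k where k: "k \<in> I" "v k j \<noteq> 0" by auto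
    with insert.prems obtain r where r: "r \<in> K" "v k j * r = 1"
      using inverse_mem[of "v k j"] by auto
    define u where "u i l = v i l - v i j * r * v k l" for i l
    have u: "u i l \<in> K" if "i \<in> I" "l \<in> J" for i l
      using that k r insert.prems unfolding u_def by (intro closed) auto
    have "card J < card (I - {k})"
      using insert.prems insert.hyps k by auto
    then obtain c where c: "\<forall>i. c i \<in> K" "\<exists>i\<in>I - {k}. c i \<noteq> 0"
        "\<forall>l\<in>J. (\<Sum>i\<in>I - {k}. c i * u i l) = 0"
      using insert.IH[of "I - {k}" u] u insert.prems by auto
    define s where "s = (\<Sum>i\<in>I - {k}. c i * v i j)"
    define d where "d = c(k := - s * r)"
    have s: "s \<in> K" unfolding s_def using c insert.prems by (auto intro!: closed)
    have split: "(\<Sum>i\<in>I. d i * v i l) = - s * r * v k l + (\<Sum>i\<in>I - {k}. c i * v i l)" for l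
      using k insert.prems by (subst sum.remove[of I k]) (auto simp: d_def intro!: sum.cong)
    have "(\<Sum>i\<in>I. d i * v i l) = 0" if "l \<in> insert j J" for l
    proof (cases "l = j")
      case True
      show ?thesis using r unfolding True split s_def[symmetric] by (simp add: mult.assoc mult.commute[of r])
    next
      case False
      with that have "0 = (\<Sum>i\<in>I - {k}. c i * u i l)" using c by auto
      also have "\<dots> = (\<Sum>i\<in>I - {k}. c i * v i l) - s * r * v k l"
        unfolding u_def s_def by (simp add: algebra_simps sum_subtractf sum_distrib_left)
      finally show ?thesis unfolding split by simp
    qed
    moreover have "\<forall>i. d i \<in> K" using c s r by (auto simp: d_def intro!: closed)
    moreover have "\<exists>i\<in>I. d i \<noteq> 0" using c by (auto simp: d_def)
    ultimately show ?thesis by blast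
  qed
qed

end

locale hardy_extension = F: hardy_field F + L: hardy_field L for F L +
  assumes subset: "F \<subseteq> L"
begin

lemma poly_mem: "over F p \<Longrightarrow> t \<in> L \<Longrightarrow> poly p t \<in> L"
  using L.poly_mem over_mono subset by blast

lemma deriv_poly:
  assumes "over F p" "t \<in> L"
  shows "\<partial> (poly p t) = poly (map_poly \<partial> p) t + poly (formal_deriv p) t * \<partial> t"
  using assms(1)
proof (induction p)
  case (pCons a p)
  then have *: "a \<in> L" "over F p" using subset by auto
  then have "poly p t \<in> L" using assms(2) by (intro poly_mem)
  then have "\<partial> (poly (pCons a p) t) = \<partial> a + (\<partial> t * poly p t + t * \<partial> (poly p t))"
    using * assms(2) by (simp add: L.deriv_add L.deriv_mult L.closed)
  then show ?case
    using pCons.IH[OF *(2)] by (simp add: map_poly_pCons formal_deriv_pCons algebra_simps)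
qed auto

lemma over_map_deriv: "over F p \<Longrightarrow> over F (map_poly \<partial> p)"
  by (auto simp: over_def coeff_map_poly intro: F.deriv_mem)

lemma adjoin_subset: "t \<in> L \<Longrightarrow> adjoin F t \<subseteq> L"
  unfolding adjoin_def using L.quotient_mem poly_mem by blast

lemma mem_adjoin: "t \<in> adjoin F t"
  unfolding adjoin_def
  by (rule CollectI, rule exI[of _ "[:0,1:]"], rule exI[of _ "[:1:]"]) simp

lemma poly_mem_adjoin: "over F p \<Longrightarrow> poly p t \<in> adjoin F t"
  unfolding adjoin_def
  by (rule CollectI, rule exI[of _ p], rule exI[of _ "[:1:]"]) simp

lemma subset_adjoin: "F \<subseteq> adjoin F t"
  using poly_mem_adjoin[of "[:_:]"] by auto

lemma field_adjoin:
  assumes "t \<in> L"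
  shows "germ_field (adjoin F t)"
proof
  have "x + y \<in> adjoin F t \<and> x - y \<in> adjoin F t \<and> x * y \<in> adjoin F t"
    if xy: "x \<in> adjoin F t" "y \<in> adjoin F t" for x y
  proof -
    obtain p q r s where *: "over F p" "over F q" "poly q t \<noteq> 0" "x * poly q t = poly p t"
        "over F r" "over F s" "poly s t \<noteq> 0" "y * poly s t = poly r t"
      using xy unfolding adjoin_def by blast
    have nz: "poly (q * s) t \<noteq> 0"
      using L.mult_nonzero[OF poly_mem[OF *(2) assms]] *(3,7) by simp
    have "(x + y) * poly (q * s) t = poly (p * s + r * q) t"
      "(x - y) * poly (q * s) t = poly (p * s - r * q) t"
      "(x * y) * poly (q * s) t = poly (p * r) t"
      by (simp_all add: *(4,8)[symmetric] algebra_simps)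
    moreover have "over F (q * s)" "over F (p * s + r * q)" "over F (p * s - r * q)" "over F (p * r)"
      using * by (auto intro!: F.over_closed)
    ultimately show ?thesis using nz unfolding adjoin_def by blast
  qed
  moreover have "\<exists>y\<in>adjoin F t. x * y = 1" if x: "x \<in> adjoin F t" "x \<noteq> 0" for x
  proof -
    obtain p q where *: "over F p" "over F q" "poly q t \<noteq> 0" "x * poly q t = poly p t"
      using x(1) unfolding adjoin_def by blast
    have "x \<in> L" using x adjoin_subset[OF assms] by blast
    then obtain y where y: "y \<in> L" "x * y = 1" using x L.inverse_mem by blast
    have "poly p t \<noteq> 0"
      using L.mult_nonzero[OF \<open>x \<in> L\<close> x(2) *(3)] *(4) by simp
    moreover have "y * poly p t = poly q t"
      unfolding *(4)[symmetric] using y(2) by (metis mult.commute mult.left_commute mult_1_right)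
    ultimately show ?thesis using y(2) * unfolding adjoin_def by blast
  qed
  ultimately show "germ_subfield (adjoin F t)"
    using subset_adjoin F.zero_mem F.one_mem unfolding germ_subfield_def by blast
qed

lemma hardy_adjoin:
  assumes "t \<in> L" "\<partial> t \<in> adjoin F t"
  shows "hardy_field (adjoin F t)"
proof -
  interpret A: germ_field "adjoin F t" by (rule field_adjoin) fact
  have d: "\<partial> (poly p t) \<in> adjoin F t" if "over F p" for p
    unfolding deriv_poly[OF that assms(1)]
    by (intro A.closed poly_mem_adjoin over_map_deriv F.over_formal_deriv that assms)
  show ?thesis
  proof
    show "adjoin F t \<subseteq> C_less_infty" using adjoin_subset[OF assms(1)] L.smooth by blast
    fix x assume x: "x \<in> adjoin F t"
    then obtain p q where *: "over F p" "over F q" "poly q t \<noteq> 0" "x * poly q t = poly p t"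
      unfolding adjoin_def by blast
    have "x \<in> L" using x adjoin_subset[OF assms(1)] by blast
    then have "\<partial> x * poly q t + x * \<partial> (poly q t) = \<partial> (poly p t)"
      using L.deriv_mult[of x "poly q t"] *(4) poly_mem[OF *(2) assms(1)] by simp
    then have "\<partial> x * poly q t = \<partial> (poly p t) - x * \<partial> (poly q t)" by (simp add: algebra_simps)
    moreover have "\<partial> (poly p t) - x * \<partial> (poly q t) \<in> adjoin F t"
      using x d * by (intro A.closed) auto
    ultimately show "\<partial> x \<in> adjoin F t"
      using A.quotient_mem poly_mem_adjoin *(2,3) by blast
  qed
qed

text \<open>
  Differentiate the equation \<open>p(t) = 0\<close> for \<open>p\<close> of least degree. The coefficient of \<open>\<partial> t\<close> is the value
  at \<open>t\<close> of the formal derivative of \<open>p\<close>, which has smaller degree and is not \<open>0\<close> in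
  characteristic zero; so it does not vanish at \<open>t\<close>.
\<close>
lemma deriv_algebraic_mem_adjoin:
  assumes "t \<in> L" "algebraic_over F t"
  shows "\<partial> t \<in> adjoin F t"
proof -
  obtain p where p: "over F p" "p \<noteq> 0" "poly p t = 0"
      and min: "\<And>q. over F q \<Longrightarrow> q \<noteq> 0 \<Longrightarrow> poly q t = 0 \<Longrightarrow> degree p \<le> degree q"
    using ex_has_least_nat[of "\<lambda>p. over F p \<and> p \<noteq> 0 \<and> poly p t = 0" _ degree] assms(2)
    unfolding algebraic_over_def by blast
  have pos: "degree p > 0"
  proof (rule ccontr)
    assume "\<not> degree p > 0"
    then obtain a where "p = [:a:]" using degree_eq_zeroE by blast
    with p show False by simp
  qed
  let ?d = "formal_deriv p"
  have "coeff ?d (degree p - 1) = of_nat (degree p) * lead_coeff p"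
    using pos by (simp add: coeff_formal_deriv del: of_nat_Suc)
  moreover have "of_nat (degree p) * lead_coeff p \<noteq> 0"
    using p(2) pos F.of_nat_mem by (intro F.mult_nonzero) auto
  ultimately have nz: "?d \<noteq> 0" by auto
  have "degree ?d \<le> degree p - 1"
    by (rule degree_le) (auto simp: coeff_formal_deriv coeff_eq_0)
  with pos have "degree ?d < degree p" by linarith
  with min[OF F.over_formal_deriv[OF p(1)] nz] have "poly ?d t \<noteq> 0" by auto
  moreover have "\<partial> t * poly ?d t = poly (- map_poly \<partial> p) t"
    using deriv_poly[OF p(1) assms(1)] p(3) by (simp add: algebra_simps eq_neg_iff_add_eq_0)
  ultimately show ?thesis
    using F.over_formal_deriv[OF p(1)] F.over_uminus[OF over_map_deriv[OF p(1)]]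
    unfolding adjoin_def by blast
qed

lemma algebraic_basis:
  assumes "t \<in> L" "algebraic_over F t"
  shows "\<exists>n a. power_basis F t n a"
proof -
  define P where "P n c \<longleftrightarrow> (\<forall>i. c i \<in> F) \<and> c n \<noteq> 0 \<and> (\<Sum>i\<le>n. c i * t ^ i) = 0"
    for n and c :: "nat \<Rightarrow> germ"
  obtain p where p: "over F p" "p \<noteq> 0" "poly p t = 0"
    using assms(2) unfolding algebraic_over_def by blast
  then have "P (degree p) (coeff p)"
    unfolding P_def over_def by (simp add: poly_altdef)
  then obtain n where n: "\<exists>c. P n c" "\<And>m c. m < n \<Longrightarrow> \<not> P m c"
    using exists_least_iff[of "\<lambda>n. \<exists>c. P n c"] by blast
  then obtain c where c: "P n c" by blast
  have "n > 0" using c by (cases n) (auto simp: P_def)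
  obtain r where r: "r \<in> F" "c n * r = 1" using c F.inverse_mem unfolding P_def by blast
  have "(\<Sum>i\<le>n. c i * t ^ i) = (\<Sum>i<n. c i * t ^ i) + c n * t ^ n"
    by (simp add: lessThan_Suc_atMost[symmetric])
  then have "(\<Sum>i<n. c i * t ^ i) + c n * t ^ n = 0" using c by (simp add: P_def)
  then have "c n * t ^ n = - (\<Sum>i<n. c i * t ^ i)" by (simp add: eq_neg_iff_add_eq_0 add.commute)
  then have "r * (c n * t ^ n) = (\<Sum>i<n. (- r * c i) * t ^ i)"
    by (simp add: sum_distrib_left sum_negf mult.assoc)
  moreover have "r * (c n * t ^ n) = t ^ n"
    using r(2) by (metis mult.assoc mult.commute mult_1)
  ultimately have eq: "t ^ n = (\<Sum>i<n. (- r * c i) * t ^ i)" by simp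
  have mem: "- r * c i \<in> F" for i using r c by (auto simp: P_def intro!: F.closed)
  have indep: "d i = 0" if d: "\<forall>i. d i \<in> F" "(\<Sum>i<n. d i * t ^ i) = 0" "i < n" for d i
  proof (rule ccontr)
    assume "d i \<noteq> 0"
    define m where "m = Max {i. i < n \<and> d i \<noteq> 0}"
    have fin: "finite {i. i < n \<and> d i \<noteq> 0}" by simp
    have "m \<in> {i. i < n \<and> d i \<noteq> 0}"
      unfolding m_def by (rule Max_in) (use fin \<open>d i \<noteq> 0\<close> d(3) in auto)
    then have m: "m < n" "d m \<noteq> 0" by auto
    have "d j = 0" if "m < j" "j < n" for j
      using Max_ge[OF fin, of j] that unfolding m_def by fastforce
    then have "(\<Sum>i\<le>m. d i * t ^ i) = (\<Sum>i<n. d i * t ^ i)"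
      using m by (intro sum.mono_neutral_left) auto
    then have "P m d" using m d by (auto simp: P_def)
    with n(2)[OF m(1)] show False by blast
  qed
  show ?thesis
    unfolding power_basis_def
    using \<open>n > 0\<close> mem eq indep by (intro exI[of _ n] exI[of _ "\<lambda>i. - r * c i"]) simp
qed

text \<open>
  An algebraic element \<open>t\<close> generates \<open>F(t)\<close> as a vector space. After multiplication by a
  common denominator, the \<open>n + 1\<close> elements \<open>1, t, \<dots>, t\<^sup>n\<^sup>-\<^sup>1, x\<close> become polynomials in \<open>t\<close>, so
  they lie in an \<open>n\<close>-dimensional space and are linearly dependent; and \<open>x\<close> must occur in the relation.
\<close>
lemma algebraic_adjoin:
  assumes t: "t \<in> L" and basis: "power_basis F t n a" and x: "x \<in> adjoin F t"
  shows "\<exists>b. (\<forall>i. b i \<in> F) \<and> x = (\<Sum>i<n. b i * t ^ i)"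
proof -
  have n: "n > 0" and a: "\<And>i. a i \<in> F" "t ^ n = (\<Sum>i<n. a i * t ^ i)"
    and indep: "\<And>c i. \<forall>i. c i \<in> F \<Longrightarrow> (\<Sum>i<n. c i * t ^ i) = 0 \<Longrightarrow> i < n \<Longrightarrow> c i = 0"
    using basis unfolding power_basis_def by simp_all
  have times_t: "\<exists>b. (\<forall>i. b i \<in> F) \<and> t * (\<Sum>i<n. c i * t ^ i) = (\<Sum>i<n. b i * t ^ i)"
    if c: "\<And>i. c i \<in> F" for c
  proof -
    obtain m where m: "n = Suc m" using n by (cases n) auto
    \<comment> \<open>the coordinates shift, and \<open>t ^ n\<close> is reduced by the given relation\<close>
    define b where "b i = (if i = 0 then 0 else c (i - 1)) + c m * a i" for i
    have "t * (\<Sum>i<n. c i * t ^ i) = (\<Sum>i<n. c i * t ^ Suc i)"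
      by (simp add: sum_distrib_left mult.left_commute)
    also have "\<dots> = (\<Sum>i<m. c i * t ^ Suc i) + c m * t ^ n"
      by (simp add: m)
    also have "(\<Sum>i<m. c i * t ^ Suc i) = (\<Sum>i<n. (if i = 0 then 0 else c (i - 1)) * t ^ i)"
      by (simp add: m sum.lessThan_Suc_shift del: sum.lessThan_Suc)
    also have "\<dots> + c m * t ^ n = (\<Sum>i<n. b i * t ^ i)"
      unfolding a(2) b_def by (simp add: sum_distrib_left distrib_right sum.distrib mult.assoc)
    finally show ?thesis
      using c a(1) by (intro exI[of _ b]) (auto simp: b_def intro!: F.closed)
  qed
  have poly_span: "\<exists>b. (\<forall>i. b i \<in> F) \<and> poly p t = (\<Sum>i<n. b i * t ^ i)" if "over F p" for p
    using that
  proof (induction p)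
    case 0
    show ?case by (intro exI[of _ "\<lambda>_. 0"]) simp
  next
    case (pCons e p)
    then obtain b where b: "\<forall>i. b i \<in> F" "poly p t = (\<Sum>i<n. b i * t ^ i)" by auto
    then obtain b' where b': "\<forall>i. b' i \<in> F" "t * poly p t = (\<Sum>i<n. b' i * t ^ i)"
      using times_t[of b] by auto
    have "(if i = 0 then e else 0) * t ^ i = (if i = 0 then e else 0)" for i by simp
    then have "poly (pCons e p) t = (\<Sum>i<n. ((if i = 0 then e else 0) + b' i) * t ^ i)"
      using b'(2) n by (simp only: distrib_right sum.distrib poly_pCons) simp
    then show ?case
      using b' pCons.prems by (intro exI[of _ "\<lambda>i. (if i = 0 then e else 0) + b' i"]) (auto intro!: F.closed)
  qed
  obtain p q where pq: "over F p" "over F q" "poly q t \<noteq> 0" "x * poly q t = poly p t"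
    using x unfolding adjoin_def by blast
  \<comment> \<open>the \<open>n + 1\<close> elements to compare\<close>
  define y where "y i = (if i < n then t ^ i else x)" for i
  have "\<exists>r. over F r \<and> y i * poly q t = poly r t" for i
  proof (cases "i < n")
    case True
    then show ?thesis using pq(2)
      by (intro exI[of _ "monom 1 i * q"]) (auto simp: y_def poly_monom intro!: F.over_mult F.over_monom)
  next
    case False
    then show ?thesis using pq by (auto simp: y_def)
  qed
  then have "\<exists>b. (\<forall>j. b j \<in> F) \<and> y i * poly q t = (\<Sum>j<n. b j * t ^ j)" for i
    using poly_span by metis
  then obtain v where v: "\<And>i j. v i j \<in> F" "\<And>i. y i * poly q t = (\<Sum>j<n. v i j * t ^ j)"
    by metis
  have "\<exists>c. (\<forall>i. c i \<in> F) \<and> (\<exists>i\<in>{..n}. c i \<noteq> 0) \<and> (\<forall>j\<in>{..<n}. (\<Sum>i\<le>n. c i * v i j) = 0)"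
    by (rule F.linear_dependence) (use v(1) in auto)
  then obtain c where c: "\<And>i. c i \<in> F" "\<exists>i\<in>{..n}. c i \<noteq> 0"
      "\<forall>j\<in>{..<n}. (\<Sum>i\<le>n. c i * v i j) = 0"
    by blast
  have "(\<Sum>i\<le>n. c i * y i) * poly q t = (\<Sum>i\<le>n. \<Sum>j<n. c i * v i j * t ^ j)"
    by (simp add: sum_distrib_right sum_distrib_left mult.assoc v(2))
  also have "\<dots> = (\<Sum>j<n. (\<Sum>i\<le>n. c i * v i j) * t ^ j)"
    by (subst sum.swap) (simp add: sum_distrib_right)
  also have "\<dots> = 0" using c(3) by simp
  finally have "poly q t * (\<Sum>i\<le>n. c i * y i) = 0" by (simp add: mult.commute)
  then have "(\<Sum>i\<le>n. c i * y i) = 0"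
    using L.mult_nonzero[OF poly_mem[OF pq(2) t] pq(3)] by blast
  then have rel: "(\<Sum>i<n. c i * t ^ i) + c n * x = 0"
    by (simp add: y_def lessThan_Suc_atMost[symmetric])
  have "c n \<noteq> 0"
  proof
    assume "c n = 0"
    then have "c i = 0" if "i < n" for i using rel indep[of c i] c(1) that by simp
    with \<open>c n = 0\<close> c(2) show False by (metis atMost_iff le_neq_implies_less)
  qed
  then obtain r where r: "r \<in> F" "c n * r = 1" using F.inverse_mem c(1) by blast
  have "c n * x = - (\<Sum>i<n. c i * t ^ i)" using rel by (simp add: eq_neg_iff_add_eq_0 add.commute)
  then have "r * (c n * x) = (\<Sum>i<n. (- r * c i) * t ^ i)"
    by (simp add: sum_distrib_left sum_negf mult.assoc)
  moreover have "r * (c n * x) = x" using r(2) by (metis mult.assoc mult.commute mult_1)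
  ultimately show ?thesis
    using r(1) c(1) by (intro exI[of _ "\<lambda>i. - r * c i"]) (auto intro!: F.closed)
qed

lemma algebraic_of_mem_adjoin:
  assumes t: "t \<in> L" "algebraic_over F t" and x: "x \<in> adjoin F t"
  shows "algebraic_over F x"
proof -
  obtain n a where n: "power_basis F t n a"
    using algebraic_basis[OF t] by blast
  interpret A: germ_field "adjoin F t" by (rule field_adjoin) fact
  have "\<exists>b. (\<forall>j. b j \<in> F) \<and> x ^ i = (\<Sum>j<n. b j * t ^ j)" for i
    by (rule algebraic_adjoin[OF t(1) n]) (auto intro: A.power_mem x)
  then obtain v where v: "\<And>i j. v i j \<in> F" "\<And>i. x ^ i = (\<Sum>j<n. v i j * t ^ j)"
    by metis
  have "\<exists>c. (\<forall>i. c i \<in> F) \<and> (\<exists>i\<in>{..n}. c i \<noteq> 0) \<and> (\<forall>j\<in>{..<n}. (\<Sum>i\<le>n. c i * v i j) = 0)"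
    by (rule F.linear_dependence) (use v(1) in auto)
  then obtain c where c: "\<And>i. c i \<in> F" "\<exists>i\<in>{..n}. c i \<noteq> 0"
      "\<forall>j\<in>{..<n}. (\<Sum>i\<le>n. c i * v i j) = 0"
    by blast
  have "(\<Sum>i\<le>n. c i * x ^ i) = (\<Sum>i\<le>n. \<Sum>j<n. c i * v i j * t ^ j)"
    by (simp add: sum_distrib_left mult.assoc v(2))
  also have "\<dots> = (\<Sum>j<n. (\<Sum>i\<le>n. c i * v i j) * t ^ j)"
    by (subst sum.swap) (simp add: sum_distrib_right)
  also have "\<dots> = 0" using c(3) by simp
  finally show ?thesis using c(1,2) F.algebraic_overI[of c _ n x] by auto
qed

end

section \<open>Matrices of germs and a covariant derivative\<close>

text \<open>
  Matrices are functions of which only the entries with indices below \<open>n\<close> matter; the ring laws used here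
  hold for all indices.
\<close>
type_synonym gmat = "nat \<Rightarrow> nat \<Rightarrow> germ"

definition mprod :: "nat \<Rightarrow> gmat \<Rightarrow> gmat \<Rightarrow> gmat" where
  "mprod n A B = (\<lambda>i j. \<Sum>k<n. A i k * B k j)"

definition mtrace :: "nat \<Rightarrow> gmat \<Rightarrow> germ" where
  "mtrace n A = (\<Sum>i<n. A i i)"

definition ident :: gmat where
  "ident i j = (if i = j then 1 else 0)"

text \<open>
  If the derivative of a basis is expressed in this basis by the matrix \<open>\<Gamma>\<close>, and \<open>A\<close> is
  the matrix of multiplication by \<open>x\<close>, then this is the matrix of multiplication by \<open>\<partial> x\<close>. It is a
  derivation on matrices (\<open>cov_deriv_mprod\<close>), and the trace carries it to \<open>\<partial>\<close>
  (\<open>mtrace_cov_deriv\<close>).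
\<close>
definition cov_deriv :: "nat \<Rightarrow> gmat \<Rightarrow> gmat \<Rightarrow> gmat" where
  "cov_deriv n \<Gamma> A = (\<lambda>i j. \<partial> (A i j) + mprod n A \<Gamma> i j - mprod n \<Gamma> A i j)"

definition smooth_mat :: "gmat \<Rightarrow> bool" where
  "smooth_mat A \<longleftrightarrow> (\<forall>i j. A i j \<in> C_less_infty)"

definition horizontal :: "nat \<Rightarrow> gmat \<Rightarrow> gmat \<Rightarrow> bool" where
  "horizontal n \<Gamma> A \<longleftrightarrow> smooth_mat A \<and> (\<forall>i<n. \<forall>j<n. cov_deriv n \<Gamma> A i j = 0)"

lemmas smooth_closed = smooth_add smooth_diff smooth_mult smooth_uminus smooth_sum smooth_power smooth_deriv

lemma smooth_mprod: "smooth_mat A \<Longrightarrow> smooth_mat B \<Longrightarrow> smooth_mat (mprod n A B)"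
  by (auto simp: smooth_mat_def mprod_def intro!: smooth_closed)

lemma smooth_cov_deriv: "smooth_mat \<Gamma> \<Longrightarrow> smooth_mat A \<Longrightarrow> smooth_mat (cov_deriv n \<Gamma> A)"
  by (auto simp: smooth_mat_def mprod_def cov_deriv_def intro!: smooth_closed)

lemma mprod_assoc: "mprod n (mprod n A B) C = mprod n A (mprod n B C)"
  unfolding mprod_def
  by (intro ext, simp add: sum_distrib_left sum_distrib_right mult.assoc, rule sum.swap)

lemma deriv_mprod:
  assumes "smooth_mat A" "smooth_mat B"
  shows "\<partial> (mprod n A B i j) =
    mprod n (\<lambda>i j. \<partial> (A i j)) B i j + mprod n A (\<lambda>i j. \<partial> (B i j)) i j"
  using assms unfolding smooth_mat_def mprod_def
  by (subst smooth_deriv_sum) (auto simp: smooth_deriv_mult sum.distrib intro: smooth_closed)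

lemma mprod_add_diff:
  "mprod n (\<lambda>i j. A i j + B i j - C i j) D i j = mprod n A D i j + mprod n B D i j - mprod n C D i j"
  "mprod n D (\<lambda>i j. A i j + B i j - C i j) i j = mprod n D A i j + mprod n D B i j - mprod n D C i j"
  by (simp_all add: mprod_def algebra_simps sum.distrib sum_subtractf)

lemma cov_deriv_mprod:
  assumes "smooth_mat A" "smooth_mat B"
  shows "cov_deriv n \<Gamma> (mprod n A B) i j =
    mprod n (cov_deriv n \<Gamma> A) B i j + mprod n A (cov_deriv n \<Gamma> B) i j"
proof -
  have "mprod n (cov_deriv n \<Gamma> A) B i j =
      mprod n (\<lambda>i j. \<partial> (A i j)) B i j + mprod n A (mprod n \<Gamma> B) i j - mprod n \<Gamma> (mprod n A B) i j"
    unfolding cov_deriv_def mprod_add_diff mprod_assoc ..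
  moreover have "mprod n A (cov_deriv n \<Gamma> B) i j =
      mprod n A (\<lambda>i j. \<partial> (B i j)) i j + mprod n (mprod n A B) \<Gamma> i j - mprod n A (mprod n \<Gamma> B) i j"
    unfolding cov_deriv_def mprod_add_diff mprod_assoc ..
  ultimately show ?thesis
    by (simp add: cov_deriv_def[of n \<Gamma> "mprod n A B"] deriv_mprod[OF assms])
qed

lemma cov_deriv_scale:
  assumes "smooth_mat A" "a \<in> C_less_infty"
  shows "cov_deriv n \<Gamma> (\<lambda>i j. a * A i j) i j = \<partial> a * A i j + a * cov_deriv n \<Gamma> A i j"
proof -
  have "mprod n (\<lambda>i j. a * A i j) \<Gamma> i j = a * mprod n A \<Gamma> i j"
    "mprod n \<Gamma> (\<lambda>i j. a * A i j) i j = a * mprod n \<Gamma> A i j"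
    by (simp_all add: mprod_def sum_distrib_left mult.assoc mult.left_commute)
  then show ?thesis
    using assms by (simp add: cov_deriv_def smooth_mat_def smooth_deriv_mult algebra_simps)
qed

lemma cov_deriv_add_diff:
  assumes "smooth_mat A" "smooth_mat B" "smooth_mat C"
  shows "cov_deriv n \<Gamma> (\<lambda>i j. A i j + B i j - C i j) i j =
    cov_deriv n \<Gamma> A i j + cov_deriv n \<Gamma> B i j - cov_deriv n \<Gamma> C i j"
  using assms
  by (simp add: cov_deriv_def smooth_mat_def mprod_add_diff smooth_deriv_add smooth_deriv_diff
      smooth_closed)

lemma mtrace_cov_deriv:
  assumes "smooth_mat A"
  shows "mtrace n (cov_deriv n \<Gamma> A) = \<partial> (mtrace n A)"
proof -
  have "(\<Sum>i<n. mprod n A \<Gamma> i i) = (\<Sum>i<n. mprod n \<Gamma> A i i)"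
    unfolding mprod_def by (subst sum.swap) (simp add: mult.commute)
  then show ?thesis
    using assms unfolding mtrace_def smooth_mat_def
    by (subst smooth_deriv_sum) (auto simp: cov_deriv_def sum.distrib sum_subtractf)
qed

lemma horizontal_mprod:
  assumes "horizontal n \<Gamma> A" "horizontal n \<Gamma> B"
  shows "horizontal n \<Gamma> (mprod n A B)"
proof -
  have s: "smooth_mat A" "smooth_mat B" using assms by (simp_all add: horizontal_def)
  have "cov_deriv n \<Gamma> (mprod n A B) i j = 0" if "i < n" "j < n" for i j
    using assms that unfolding cov_deriv_mprod[OF s] unfolding mprod_def horizontal_def by simp
  then show ?thesis using s smooth_mprod by (simp add: horizontal_def)
qed

lemma horizontal_ident: "horizontal n \<Gamma> ident"
proof -
  have "ident i j * x = (if i = j then x else 0)" "x * ident i j = (if i = j then x else 0)" for i j x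
    by (auto simp: ident_def)
  then show ?thesis
    by (auto simp: horizontal_def smooth_mat_def cov_deriv_def mprod_def ident_def)
qed

lemma mtrace_horizontal:
  assumes "horizontal n \<Gamma> A"
  shows "\<exists>c. mtrace n A = of_real c"
proof (rule deriv_zero_constant)
  have s: "smooth_mat A" using assms by (simp add: horizontal_def)
  show "differentiable_germ (mtrace n A)"
    using s by (auto simp: mtrace_def smooth_mat_def intro!: smooth_differentiable smooth_closed)
  show "\<partial> (mtrace n A) = 0"
    using assms unfolding mtrace_cov_deriv[OF s, of n \<Gamma>, symmetric]
    by (simp add: horizontal_def mtrace_def)
qed

lemma mtrace_power_linear:
  "mtrace n ((mprod n M ^^ k) (\<lambda>i j. a * A i j + b * B i j + c * C i j)) =
   a * mtrace n ((mprod n M ^^ k) A) + b * mtrace n ((mprod n M ^^ k) B)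
   + c * mtrace n ((mprod n M ^^ k) C)"
proof (induction k arbitrary: A B C)
  case 0
  show ?case by (simp add: mtrace_def sum.distrib sum_distrib_left)
next
  case (Suc k)
  have "mprod n M (\<lambda>i j. a * A i j + b * B i j + c * C i j) =
      (\<lambda>i j. a * mprod n M A i j + b * mprod n M B i j + c * mprod n M C i j)"
    by (simp add: mprod_def fun_eq_iff sum_distrib_left sum.distrib algebra_simps)
  with Suc show ?case by (simp add: funpow_Suc_right del: funpow.simps)
qed

definition periodic_in :: "germ \<Rightarrow> germ \<Rightarrow> bool" where
  "periodic_in \<phi> x \<longleftrightarrow> (\<exists>u. (\<forall>s. u (s + 2 * pi) = u s) \<and> x = germ_comp u \<phi>)"

lemma periodic_in_add:
  assumes "periodic_in \<phi> x" "periodic_in \<phi> y"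
  shows "periodic_in \<phi> (x + y)"
proof -
  obtain u v where uv: "\<And>s. u (s + 2 * pi) = u s" "x = germ_comp u \<phi>"
      "\<And>s. v (s + 2 * pi) = v s" "y = germ_comp v \<phi>"
    using assms unfolding periodic_in_def by blast
  have "germ_comp u \<phi> + germ_comp v \<phi> = germ_comp (\<lambda>s. u s + v s) \<phi>"
    by transfer simp
  then show ?thesis using uv unfolding periodic_in_def by (intro exI[of _ "\<lambda>s. u s + v s"]) simp
qed

lemma periodic_in_mult:
  assumes "periodic_in \<phi> x" "periodic_in \<phi> y"
  shows "periodic_in \<phi> (x * y)"
proof -
  obtain u v where uv: "\<And>s. u (s + 2 * pi) = u s" "x = germ_comp u \<phi>"
      "\<And>s. v (s + 2 * pi) = v s" "y = germ_comp v \<phi>"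
    using assms unfolding periodic_in_def by blast
  have "germ_comp u \<phi> * germ_comp v \<phi> = germ_comp (\<lambda>s. u s * v s) \<phi>"
    by transfer simp
  then show ?thesis using uv unfolding periodic_in_def by (intro exI[of _ "\<lambda>s. u s * v s"]) simp
qed

lemma periodic_in_of_real: "periodic_in \<phi> (of_real c)"
proof -
  have "of_real c = germ_comp (\<lambda>_. c) \<phi>" unfolding of_real_germ by transfer simp
  then show ?thesis unfolding periodic_in_def by (intro exI[of _ "\<lambda>_. c"]) simp
qed

lemma periodic_in_cos_sin:
  "periodic_in \<phi> (germ_comp cos (\<phi> + \<phi>))" "periodic_in \<phi> (germ_comp sin (\<phi> + \<phi>))"
proof -
  have per: "cos (s + 2 * pi + (s + 2 * pi)) = cos (s + s)"
    "sin (s + 2 * pi + (s + 2 * pi)) = sin (s + s)" for s :: real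
    using cos_periodic[of "s + s + 2 * pi"] sin_periodic[of "s + s + 2 * pi"]
      cos_periodic[of "s + s"] sin_periodic[of "s + s"]
    by (simp_all add: algebra_simps)
  have "germ_comp cos (\<phi> + \<phi>) = germ_comp (\<lambda>s. cos (s + s)) \<phi>"
    by transfer simp
  then show "periodic_in \<phi> (germ_comp cos (\<phi> + \<phi>))"
    unfolding periodic_in_def using per by (intro exI[of _ "\<lambda>s. cos (s + s)"]) simp
  have "germ_comp sin (\<phi> + \<phi>) = germ_comp (\<lambda>s. sin (s + s)) \<phi>"
    by transfer simp
  then show "periodic_in \<phi> (germ_comp sin (\<phi> + \<phi>))"
    unfolding periodic_in_def using per by (intro exI[of _ "\<lambda>s. sin (s + s)"]) simp
qed

text \<open>
  Expanding \<open>M\<^sup>k C\<close> gives products of \<open>N1\<close>, \<open>N2\<close>, \<open>N3\<close> and \<open>C\<close>. These are horizontal, so their traces are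
  real constants; their coefficients are \<open>w\<^sup>k\<close> times polynomials in \<open>a\<close>, \<open>b\<close>, \<open>c\<close>. The extra factor
  \<open>C\<close> absorbs one horizontal matrix in each step of the induction.
\<close>
lemma trace_power_periodic:
  assumes N: "horizontal n \<Gamma> N1" "horizontal n \<Gamma> N2" "horizontal n \<Gamma> N3"
    and M: "\<And>i j. M i j = w * a * N1 i j + w * b * N2 i j + w * c * N3 i j"
    and per: "periodic_in \<phi> a" "periodic_in \<phi> b" "periodic_in \<phi> c"
    and C: "horizontal n \<Gamma> C"
  shows "\<exists>x. periodic_in \<phi> x \<and> mtrace n ((mprod n M ^^ k) C) = w ^ k * x"
  using C
proof (induction k arbitrary: C)
  case 0
  then obtain r where "mtrace n C = of_real r" using mtrace_horizontal by blast
  then show ?case using periodic_in_of_real by (intro exI[of _ "of_real r"]) simp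
next
  case (Suc k)
  define A where "A N = mtrace n ((mprod n M ^^ k) (mprod n N C))" for N
  have "mprod n M C = (\<lambda>i j. (w * a) * mprod n N1 C i j + (w * b) * mprod n N2 C i j
      + (w * c) * mprod n N3 C i j)"
    by (simp add: mprod_def fun_eq_iff M sum_distrib_left sum.distrib algebra_simps)
  then have eq: "mtrace n ((mprod n M ^^ Suc k) C) = w * a * A N1 + w * b * A N2 + w * c * A N3"
    by (simp add: A_def funpow_Suc_right mtrace_power_linear del: funpow.simps)
  obtain x1 x2 x3 where x: "periodic_in \<phi> x1" "A N1 = w ^ k * x1" "periodic_in \<phi> x2" "A N2 = w ^ k * x2"
      "periodic_in \<phi> x3" "A N3 = w ^ k * x3"
    using Suc.IH[OF horizontal_mprod[OF _ Suc.prems]] N unfolding A_def by meson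
  show ?case
    using x(1,3,5) per unfolding eq x(2,4,6)
    by (intro exI[of _ "a * x1 + b * x2 + c * x3"]) (simp add: algebra_simps periodic_in_add periodic_in_mult)
qed

section \<open>The symmetric square equation\<close>

text \<open>
  Here \<open>w\<close> is the square of the amplitude of the solutions of \<open>Y'' + fY = 0\<close> with phase \<open>\<phi>\<close>; the last
  assumption is Pinney's equation \<open>v'' + fv = v\<^sup>-\<^sup>3\<close> for the amplitude \<open>v\<close>, written in terms of \<open>w = v\<^sup>2\<close>.
\<close>
locale phase = hardy_field L for L +
  fixes \<phi> f w :: germ
  assumes reals: "\<real> \<subseteq> L"
    and phase_mem: "\<phi> \<in> L" and coeff_mem: "f \<in> L" and w_mem: "w \<in> L"
    and phase_infinite: "\<And>c. of_real c < \<phi>"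
    and phase_deriv: "\<partial> \<phi> * w = 1"
    and pinney: "2 * w * \<partial> (\<partial> w) - (\<partial> w)\<^sup>2 + 4 * f * w\<^sup>2 = 4"
begin

text \<open>
  The symmetric square of \<open>Y'' + fY\<close>: it annihilates all products of two solutions of \<open>Y'' + fY = 0\<close>.
\<close>
definition sym_op :: "germ \<Rightarrow> germ" where
  "sym_op z = \<partial> (\<partial> (\<partial> z)) + 4 * f * \<partial> z + 2 * \<partial> f * z"

lemma w_nonzero: "w \<noteq> 0"
  using phase_deriv by auto

text \<open>
  By this identity, a nonzero germ in \<open>L\<close> solves the symmetric square if and only if the quadratic form in
  Pinney's equation is constant on it.
\<close>
lemma pinney_deriv: "z \<in> L \<Longrightarrow> \<partial> (2 * z * \<partial> (\<partial> z) - (\<partial> z)\<^sup>2 + 4 * f * z\<^sup>2) = 2 * z * sym_op z"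
  using coeff_mem
  by (simp add: power2_eq_square deriv_add deriv_diff deriv_mult closed_deriv sym_op_def algebra_simps)

lemma sym_op_pinney:
  assumes "z \<in> L" "z \<noteq> 0" "2 * z * \<partial> (\<partial> z) - (\<partial> z)\<^sup>2 + 4 * f * z\<^sup>2 = of_real c"
  shows "sym_op z = 0"
proof -
  have "2 * z * sym_op z = 0" using pinney_deriv[OF assms(1)] assms(3) by simp
  moreover have "2 * z \<in> L" "2 * z \<noteq> 0"
    using assms mult_nonzero[of 2 z] by (auto intro: mult_mem)
  ultimately show ?thesis using cancel[of "2 * z" "sym_op z" 0] by simp
qed

lemma sym_op_w: "sym_op w = 0"
  using sym_op_pinney[OF w_mem w_nonzero, of 4] pinney by simp

definition cos2 :: germ where "cos2 = germ_comp cos (\<phi> + \<phi>)"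
definition sin2 :: germ where "sin2 = germ_comp sin (\<phi> + \<phi>)"
abbreviation p :: germ where "p \<equiv> \<partial> \<phi>"

lemma p_mem: "p \<in> L" by (rule deriv_mem[OF phase_mem])

lemma smooth_trig: "cos2 \<in> C_less_infty" "sin2 \<in> C_less_infty"
  unfolding cos2_def sin2_def by (intro smooth_cos_sin smooth_add smoothI phase_mem)+

lemma deriv_trig: "\<partial> cos2 = - (2 * p * sin2)" "\<partial> sin2 = 2 * p * cos2"
proof -
  have "differentiable_germ (\<phi> + \<phi>)"
    using smooth_differentiable smooth_add smoothI[OF phase_mem] by blast
  moreover have "\<partial> (\<phi> + \<phi>) = 2 * p" using deriv_add[OF phase_mem phase_mem] by simp
  ultimately show "\<partial> cos2 = - (2 * p * sin2)" "\<partial> sin2 = 2 * p * cos2"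
    by (simp_all add: cos2_def sin2_def germ_deriv_cos germ_deriv_sin)
qed

lemma trig_pythagoras: "cos2 * cos2 + sin2 * sin2 = 1"
  unfolding cos2_def sin2_def by transfer (simp add: power2_eq_square[symmetric])

lemma deriv_p: "\<partial> p = - (p * p * \<partial> w)"
proof -
  have "\<partial> (p * w) = 0" using phase_deriv by simp
  then have "\<partial> p * w + p * \<partial> w = 0" using deriv_mult[OF p_mem w_mem] by simp
  then have "p * (\<partial> p * w + p * \<partial> w) = 0" by simp
  then have "\<partial> p * (p * w) + p * p * \<partial> w = 0" by (simp add: algebra_simps)
  then show ?thesis using phase_deriv by (simp add: eq_neg_iff_add_eq_0)
qed

lemma pinney_p: "4 * p * \<partial> (\<partial> w) = 2 * p * p * \<partial> w * \<partial> w - 8 * f + 8 * p * p"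
proof -
  have "2 * p * p * (2 * w * \<partial> (\<partial> w) - (\<partial> w)\<^sup>2 + 4 * f * w\<^sup>2) = 8 * p * p"
    unfolding pinney by simp
  moreover have "2 * p * p * (2 * w * \<partial> (\<partial> w) - (\<partial> w)\<^sup>2 + 4 * f * w\<^sup>2)
     = 4 * p * (p * w) * \<partial> (\<partial> w) - 2 * p * p * \<partial> w * \<partial> w + 8 * f * (p * w) * (p * w)"
    by (simp add: power2_eq_square algebra_simps)
  ultimately show ?thesis unfolding phase_deriv by (simp add: algebra_simps)
qed

lemmas smooth_mems = smoothI[OF w_mem] smoothI[OF p_mem] smoothI[OF coeff_mem] smooth_trig

lemma deriv_w_trig:
  "\<partial> (w * cos2) = \<partial> w * cos2 - 2 * sin2"
  "\<partial> (w * sin2) = \<partial> w * sin2 + 2 * cos2"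
proof -
  have "w * (2 * p * x) = 2 * x" for x
    using phase_deriv by (metis mult.assoc mult.commute mult_1)
  then show "\<partial> (w * cos2) = \<partial> w * cos2 - 2 * sin2"
    "\<partial> (w * sin2) = \<partial> w * sin2 + 2 * cos2"
    by (simp_all add: smooth_deriv_mult smooth_mems deriv_trig)
qed

lemma deriv2_w_trig:
  "\<partial> (\<partial> (w * cos2)) = \<partial> (\<partial> w) * cos2 - 2 * p * \<partial> w * sin2 - 4 * p * cos2"
  "\<partial> (\<partial> (w * sin2)) = \<partial> (\<partial> w) * sin2 + 2 * p * \<partial> w * cos2 - 4 * p * sin2"
  unfolding deriv_w_trig
  by (simp_all add: smooth_deriv_mult smooth_deriv_add smooth_deriv_diff smooth_mems smooth_closed
      deriv_trig algebra_simps)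

lemma sym_op_w_trig: "sym_op (w * cos2) = 0" "sym_op (w * sin2) = 0"
proof -
  have coeffs: "4 * p * \<partial> (\<partial> w) + 2 * \<partial> p * \<partial> w - 8 * p * p + 8 * f = 0"
    "4 * p * p * \<partial> w + 4 * \<partial> p = 0"
    using pinney_p by (simp_all add: deriv_p algebra_simps)
  have "sym_op (w * cos2) = sym_op w * cos2
      - sin2 * (4 * p * \<partial> (\<partial> w) + 2 * \<partial> p * \<partial> w - 8 * p * p + 8 * f)
      - cos2 * (4 * p * p * \<partial> w + 4 * \<partial> p)"
    unfolding sym_op_def deriv2_w_trig
    by (simp add: deriv_w_trig smooth_deriv_mult smooth_deriv_add smooth_deriv_diff smooth_mems smooth_closed
      deriv_trig algebra_simps)
  then show "sym_op (w * cos2) = 0"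
    by (simp only: sym_op_w coeffs) simp
  have "sym_op (w * sin2) = sym_op w * sin2
      + cos2 * (4 * p * \<partial> (\<partial> w) + 2 * \<partial> p * \<partial> w - 8 * p * p + 8 * f)
      - sin2 * (4 * p * p * \<partial> w + 4 * \<partial> p)"
    unfolding sym_op_def deriv2_w_trig
    by (simp add: deriv_w_trig smooth_deriv_mult smooth_deriv_add smooth_deriv_diff smooth_mems smooth_closed
      deriv_trig algebra_simps)
  then show "sym_op (w * sin2) = 0"
    by (simp only: sym_op_w coeffs) simp
qed

text \<open>
  The polarization \<open>M z'' - M' z' + M'' z + 4 f M z\<close> of the quadratic form in Pinney's equation. On a
  solution \<open>z\<close> and a matrix solution \<open>M\<close> of the symmetric square it is constant, that is, horizontal.
\<close>
definition pairing :: "nat \<Rightarrow> gmat \<Rightarrow> gmat \<Rightarrow> germ \<Rightarrow> gmat" where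
  "pairing n \<Gamma> M z = (\<lambda>i j. (\<partial> (\<partial> z) + 4 * f * z) * M i j + z * cov_deriv n \<Gamma> (cov_deriv n \<Gamma> M) i j
     - \<partial> z * cov_deriv n \<Gamma> M i j)"

definition sym_solution :: "nat \<Rightarrow> gmat \<Rightarrow> gmat \<Rightarrow> bool" where
  "sym_solution n \<Gamma> M \<longleftrightarrow> (\<forall>i<n. \<forall>j<n. cov_deriv n \<Gamma> (cov_deriv n \<Gamma> (cov_deriv n \<Gamma> M)) i j
     + 4 * f * cov_deriv n \<Gamma> M i j + 2 * \<partial> f * M i j = 0)"

lemma horizontal_pairing:
  assumes s: "smooth_mat \<Gamma>" "smooth_mat M" and M: "sym_solution n \<Gamma> M"
    and z: "z \<in> C_less_infty" "sym_op z = 0"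
  shows "horizontal n \<Gamma> (pairing n \<Gamma> M z)"
proof -
  let ?D = "cov_deriv n \<Gamma>"
  have s': "smooth_mat (?D M)" "smooth_mat (?D (?D M))"
    using s by (simp_all add: smooth_cov_deriv)
  have z': "\<partial> (\<partial> z) + 4 * f * z \<in> C_less_infty" "\<partial> z \<in> C_less_infty"
    using z smooth_mems by (auto intro!: smooth_closed)
  have sc: "smooth_mat (\<lambda>i j. a * A i j)" if "a \<in> C_less_infty" "smooth_mat A" for a A
    using that by (auto simp: smooth_mat_def intro: smooth_closed)
  have "?D (pairing n \<Gamma> M z) i j = 0" if "i < n" "j < n" for i j
  proof -
    have D3: "?D (?D (?D M)) i j = - (4 * f * ?D M i j) - 2 * \<partial> f * M i j"
      using M that unfolding sym_solution_def by (simp add: algebra_simps eq_neg_iff_add_eq_0 eq_diff_eq)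
    have "?D (pairing n \<Gamma> M z) i j = \<partial> (\<partial> (\<partial> z) + 4 * f * z) * M i j + (\<partial> (\<partial> z) + 4 * f * z) * ?D M i j
        + (\<partial> z * ?D (?D M) i j + z * ?D (?D (?D M)) i j)
        - (\<partial> (\<partial> z) * ?D M i j + \<partial> z * ?D (?D M) i j)"
      unfolding pairing_def
      by (simp add: cov_deriv_add_diff cov_deriv_scale sc s s' z' z(1))
    also have "\<dots> = sym_op z * M i j"
      unfolding D3 sym_op_def using z(1) smooth_mems
      by (simp add: smooth_deriv_add smooth_deriv_mult smooth_closed algebra_simps)
    finally show ?thesis using z(2) by simp
  qed
  moreover have "smooth_mat (pairing n \<Gamma> M z)"
    using s s' z z' by (auto simp: pairing_def smooth_mat_def intro!: smooth_closed)
  ultimately show ?thesis by (simp add: horizontal_def)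
qed

text \<open>
  The quadratic form in Pinney's equation has signature \<open>(1,2)\<close> on the span of \<open>w\<close>, \<open>w cos 2\<phi>\<close>,
  \<open>w sin 2\<phi>\<close>, and these are an orthogonal basis with values \<open>4\<close>, \<open>-4\<close>, \<open>-4\<close>. This is the expansion of
  \<open>M\<close> in that basis.
\<close>
lemma pairing_decomposition:
  "4 * M i j = w * pairing n \<Gamma> M w i j - (w * cos2) * pairing n \<Gamma> M (w * cos2) i j
     - (w * sin2) * pairing n \<Gamma> M (w * sin2) i j"
proof -
  let ?A = "M i j" and ?B = "cov_deriv n \<Gamma> M i j" and ?C = "cov_deriv n \<Gamma> (cov_deriv n \<Gamma> M) i j"
  have pyth: "cos2 * (cos2 * x) = x - sin2 * (sin2 * x)" for x
  proof -
    have "(cos2 * cos2 + sin2 * sin2) * x = x" by (simp add: trig_pythagoras)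
    then show ?thesis by (simp add: algebra_simps eq_diff_eq)
  qed
  have pw: "w * (p * x) = x" for x
    using phase_deriv by (metis mult.assoc mult.commute mult_1)
  show ?thesis
    unfolding pairing_def deriv2_w_trig unfolding deriv_w_trig
    by (simp add: algebra_simps pyth pw)
qed

lemma trace_power_periodic_in:
  assumes "smooth_mat \<Gamma>" "smooth_mat M" "sym_solution n \<Gamma> M"
  shows "\<exists>x. periodic_in \<phi> x \<and> mtrace n ((mprod n M ^^ k) ident) = w ^ k * x"
proof (rule trace_power_periodic)
  define r :: germ where "r = of_real (1 / 4)"
  have r: "r * 4 = 1"
    unfolding r_def using of_real_mult[of "1/4" 4, where 'a = germ] by simp
  show "horizontal n \<Gamma> (pairing n \<Gamma> M w)" "horizontal n \<Gamma> (pairing n \<Gamma> M (w * cos2))"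
    "horizontal n \<Gamma> (pairing n \<Gamma> M (w * sin2))"
    by (intro horizontal_pairing assms sym_op_w sym_op_w_trig smooth_mems smooth_mult)+
  show "M i j = w * r * pairing n \<Gamma> M w i j + w * (- r * cos2) * pairing n \<Gamma> M (w * cos2) i j
      + w * (- r * sin2) * pairing n \<Gamma> M (w * sin2) i j" for i j
  proof -
    have "M i j = r * (4 * M i j)" using r by (simp add: mult.assoc[symmetric])
    then show ?thesis unfolding pairing_decomposition[of M i j n \<Gamma>] by (simp add: algebra_simps)
  qed
  have "- r = of_real (- 1 / 4)" by (simp add: r_def)
  then show "periodic_in \<phi> r" "periodic_in \<phi> (- r * cos2)" "periodic_in \<phi> (- r * sin2)"
    unfolding r_def cos2_def sin2_def
    by (metis periodic_in_of_real periodic_in_mult periodic_in_cos_sin)+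
  show "horizontal n \<Gamma> ident" by (rule horizontal_ident)
qed

lemma trace_power_constant:
  assumes "smooth_mat \<Gamma>" "smooth_mat M" "sym_solution n \<Gamma> M"
    and mem: "mtrace n ((mprod n M ^^ k) ident) \<in> L"
  shows "\<exists>c. mtrace n ((mprod n M ^^ k) ident) = of_real c * w ^ k"
proof -
  obtain u where u: "\<And>s. u (s + 2 * pi) = u s"
      "mtrace n ((mprod n M ^^ k) ident) = w ^ k * germ_comp u \<phi>"
    using trace_power_periodic_in[OF assms(1-3), of k] unfolding periodic_in_def by blast
  have wk: "w ^ k \<in> L" "w ^ k \<noteq> 0"
    using w_mem w_nonzero power_mem power_nonzero by auto
  have "germ_comp u \<phi> \<in> L"
    by (rule quotient_mem[OF _ mem wk]) (simp add: u mult.commute)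
  moreover have "\<phi> \<in> Cn 0" using smoothI[OF phase_mem] by (simp add: C_less_infty_def)
  ultimately have "germ_comp u \<phi> = of_real (u 0)"
    using periodic_germ_constant[of L \<phi> u] hardy_field_axioms reals phase_infinite u(1) by blast
  then show ?thesis unfolding u(2) by (metis mult.commute)
qed

text \<open>
  This is the case of one-by-one matrices with \<open>\<Gamma> = 0\<close> and \<open>k = 1\<close>.
\<close>
lemma sym_op_kernel:
  assumes "v \<in> L" "sym_op v = 0"
  shows "\<exists>c. v = of_real c * w"
proof -
  define M \<Gamma> :: gmat where "M = (\<lambda>i j. v)" and "\<Gamma> = (\<lambda>i j. 0)"
  have D: "cov_deriv 1 \<Gamma> (\<lambda>i j. x) = (\<lambda>i j. \<partial> x)" for x
    by (simp add: \<Gamma>_def cov_deriv_def mprod_def)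
  have s: "smooth_mat \<Gamma>" "smooth_mat M"
    using smoothI[OF assms(1)] by (auto simp: smooth_mat_def M_def \<Gamma>_def)
  have tr: "mtrace 1 ((mprod 1 M ^^ 1) ident) = v"
    by (simp add: mtrace_def mprod_def M_def ident_def)
  have "sym_solution 1 \<Gamma> M"
    using assms(2) unfolding sym_solution_def M_def D by (simp add: sym_op_def)
  from trace_power_constant[OF s this, of 1] show ?thesis
    unfolding tr using assms(1) by simp
qed

end

section \<open>The amplitude is determined by its equation\<close>

text \<open>
  Differences of distinct real numbers are units, so linear factors can be split off as over a field.
\<close>
lemma finite_real_roots:
  fixes q :: "germ poly"
  assumes "q \<noteq> 0"
  shows "finite {x :: real. poly q (of_real x) = 0}"
  using assms
proof (induction "degree q" arbitrary: q rule: less_induct)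
  case less
  show ?case
  proof (cases "\<exists>r :: real. poly q (of_real r) = 0")
    case True
    then obtain r :: real where r: "poly q (of_real r) = 0" by blast
    define s where "s = synthetic_div q (of_real r)"
    have q: "q = [:- of_real r, 1:] * s"
      using synthetic_div_correct'[of "of_real r" q] r unfolding s_def by simp
    have "s \<noteq> 0" using q less.prems by auto
    have "degree q \<noteq> 0"
    proof
      assume "degree q = 0"
      then obtain a where "q = [:a:]" by (rule degree_eq_zeroE)
      with r less.prems show False by simp
    qed
    then have "degree s < degree q" by (simp add: s_def degree_synthetic_div)
    with less.hyps \<open>s \<noteq> 0\<close> have fin: "finite {x :: real. poly s (of_real x) = 0}" by blast
    have "poly s (of_real x) = 0" if "poly q (of_real x) = 0" "x \<noteq> r" for x :: real
    proof -
      have "of_real (x - r) * poly s (of_real x) = 0"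
        using that(1) unfolding q by (simp add: algebra_simps)
      then have "(x - r) *\<^sub>R poly s (of_real x) = 0" by (simp only: scaleR_conv_of_real)
      with that(2) show ?thesis by simp
    qed
    then have "{x :: real. poly q (of_real x) = 0} \<subseteq> insert r {x. poly s (of_real x) = 0}" by auto
    with fin show ?thesis by (meson finite_insert finite_subset)
  qed simp
qed

lemma algebraic_over_square:
  assumes "algebraic_over K (t\<^sup>2)" "0 \<in> K"
  shows "algebraic_over K t"
proof -
  obtain q where q: "over K q" "q \<noteq> 0" "poly q (t\<^sup>2) = 0"
    using assms unfolding algebraic_over_def by blast
  define r where "r = pcompose q [:0, 0, 1:]"
  have step: "pcompose (pCons a q) [:0, 0, 1:] = pCons a (pCons 0 (pcompose q [:0, 0, 1:]))"
    for a and q :: "germ poly"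
    by (simp add: pcompose_pCons)
  have "coeff r (2 * i) = coeff q i" for i
    unfolding r_def
  proof (induction q arbitrary: i)
    case (pCons a q)
    then show ?case unfolding step by (cases i) simp_all
  qed simp
  with q(2) have "r \<noteq> 0" by (metis coeff_0 poly_eqI)
  moreover have "over K r"
    using q(1) unfolding r_def
  proof (induction q)
    case 0
    then show ?case by simp
  next
    case (pCons a q)
    then show ?case unfolding step by (simp add: assms(2))
  qed
  moreover have "poly r t = 0"
    using q(3) by (simp add: r_def poly_pcompose power2_eq_square)
  ultimately show ?thesis unfolding algebraic_over_def by blast
qed

lemma hardy_field_Union:
  assumes "\<C> \<noteq> {}" "\<And>K. K \<in> \<C> \<Longrightarrow> hardy_field K"
    and chain: "\<And>A B. A \<in> \<C> \<Longrightarrow> B \<in> \<C> \<Longrightarrow> A \<subseteq> B \<or> B \<subseteq> A"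
  shows "hardy_field (\<Union>\<C>)"
proof -
  have H: "Hardy_field K" if "K \<in> \<C>" for K using assms(2)[OF that] by (simp add: hardy_field_iff)
  then have sub: "germ_subfield K" if "K \<in> \<C>" for K using that by (simp add: Hardy_field_def)
  have ops: "x + y \<in> \<Union>\<C> \<and> x - y \<in> \<Union>\<C> \<and> x * y \<in> \<Union>\<C>" if xy: "x \<in> \<Union>\<C>" "y \<in> \<Union>\<C>" for x y
  proof -
    obtain A B where "A \<in> \<C>" "x \<in> A" "B \<in> \<C>" "y \<in> B" using xy by blast
    then obtain K where K: "K \<in> \<C>" "x \<in> K" "y \<in> K"
      using chain[of A B] by (metis subsetD)
    then have "x + y \<in> K \<and> x - y \<in> K \<and> x * y \<in> K"
      using sub[of K] by (simp add: germ_subfield_def)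
    with K(1) show ?thesis by blast
  qed
  have inv: "\<exists>y\<in>\<Union>\<C>. x * y = 1" if x: "x \<in> \<Union>\<C>" "x \<noteq> 0" for x
  proof -
    obtain K where "K \<in> \<C>" "x \<in> K" using x by blast
    moreover from this obtain y where "y \<in> K" "x * y = 1"
      using sub[of K] x(2) unfolding germ_subfield_def by blast
    ultimately show ?thesis by blast
  qed
  obtain K where K: "K \<in> \<C>" using assms(1) by blast
  have "0 \<in> K" "1 \<in> K" using sub[OF K] by (simp_all add: germ_subfield_def)
  with K have const: "0 \<in> \<Union>\<C>" "1 \<in> \<Union>\<C>" by blast+
  have "germ_subfield (\<Union>\<C>)"
    unfolding germ_subfield_def using const ops inv by simp
  moreover have "\<Union>\<C> \<subseteq> C_less_infty" "\<forall>x\<in>\<Union>\<C>. \<partial> x \<in> \<Union>\<C>"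
    using H unfolding Hardy_field_def by blast+
  ultimately show ?thesis
    unfolding hardy_field_iff Hardy_field_def by simp
qed

context phase
begin

lemma of_real_mem [simp]: "of_real c \<in> L"
  using reals Reals_of_real by blast

lemma deriv_real_mult: "x \<in> L \<Longrightarrow> \<partial> (of_real c * x) = of_real c * \<partial> x"
  using deriv_mult[of "of_real c" x] by simp

definition pinney_op :: "germ \<Rightarrow> germ" where
  "pinney_op z = 2 * z * \<partial> (\<partial> z) - (\<partial> z)\<^sup>2 + 4 * f * z\<^sup>2"

text \<open>
  Pinney's equation for \<open>w\<close> in terms of \<open>w\<^sup>2\<close>, cleared of denominators. The square is used because
  \<open>w\<close> and \<open>- w\<close> satisfy the same equation.
\<close>
definition square_op :: "germ \<Rightarrow> germ" where
  "square_op V = 4 * V * \<partial> (\<partial> V) - 3 * (\<partial> V)\<^sup>2 + 16 * f * V\<^sup>2 - 16 * V"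

lemma deriv_square:
  assumes "v \<in> L"
  shows "\<partial> (v\<^sup>2) = 2 * v * \<partial> v" "\<partial> (\<partial> (v\<^sup>2)) = 2 * (\<partial> v)\<^sup>2 + 2 * v * \<partial> (\<partial> v)"
  using assms by (simp_all add: power2_eq_square deriv_mult deriv_add closed_deriv algebra_simps)

lemma square_op_square:
  assumes "v \<in> L"
  shows "square_op (of_real s * v\<^sup>2) = of_real s * (4 * v\<^sup>2) * (of_real s * pinney_op v - 4)"
proof -
  have "of_real s * v\<^sup>2 \<in> L" "v\<^sup>2 \<in> L"
    using assms by (auto intro!: closed)
  then have "\<partial> (of_real s * v\<^sup>2) = of_real s * \<partial> (v\<^sup>2)"
    "\<partial> (of_real s * \<partial> (v\<^sup>2)) = of_real s * \<partial> (\<partial> (v\<^sup>2))"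
    using deriv_mem by (simp_all only: deriv_real_mult)
  then have d: "\<partial> (of_real s * v\<^sup>2) = of_real s * (2 * v * \<partial> v)"
    "\<partial> (of_real s * (2 * v * \<partial> v)) = of_real s * (2 * (\<partial> v)\<^sup>2 + 2 * v * \<partial> (\<partial> v))"
    using deriv_square[OF assms] by simp_all
  show ?thesis
    unfolding square_op_def pinney_op_def d by (simp add: power2_eq_square algebra_simps)
qed

text \<open>
  A solution \<open>V\<close> is \<open>\<plusminus>v\<^sup>2\<close> for some \<open>v \<in> L\<close>, and then the quadratic form in Pinney's equation has
  the value \<open>\<plusminus>4\<close> at \<open>v\<close>. So \<open>v\<close> solves the symmetric square, whence \<open>v = cw\<close> for a real number \<open>c\<close>; and
  \<open>c\<^sup>2 = \<plusminus>1\<close> excludes the negative sign.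
\<close>
lemma square_unique:
  assumes sqrt: "\<And>g. g \<in> L \<Longrightarrow> g > 0 \<Longrightarrow> \<exists>h\<in>L. h\<^sup>2 = g"
    and V: "V \<in> L" "V \<noteq> 0" "square_op V = 0"
  shows "V = w\<^sup>2"
proof -
  obtain s :: real and v where v: "s = 1 \<or> s = -1" "v \<in> L" "V = of_real s * v\<^sup>2"
  proof (cases "V > 0")
    case True
    then show ?thesis using that[of 1] sqrt[OF V(1)] by force
  next
    case False
    with pos_or_neg[OF V(1,2)] have "- V > 0" using germ_neg_pos by blast
    with sqrt uminus_mem[OF V(1)] obtain v where "v \<in> L" "v\<^sup>2 = - V" by blast
    then show ?thesis using that[of "-1" v] by simp
  qed
  have "v \<noteq> 0" using V v by auto
  have "of_real s * (4 * v\<^sup>2) * (of_real s * pinney_op v - 4) = 0"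
    using V(3) square_op_square[OF v(2), of s] v(3) by simp
  moreover have "of_real s * (4 * v\<^sup>2) = of_real (4 * s) * v\<^sup>2" by simp
  moreover have "of_real (4 * s) * v\<^sup>2 \<in> L"
    using v by (intro mult_mem power_mem of_real_mem)
  moreover have "of_real (4 * s) * v\<^sup>2 \<noteq> 0"
    using power_nonzero[OF v(2) \<open>v \<noteq> 0\<close>, of 2] v(1)
    by (auto simp flip: scaleR_conv_of_real simp del: of_real_mult)
  ultimately have "of_real s * pinney_op v - 4 = 0"
    using cancel[of "of_real (4 * s) * v\<^sup>2" "of_real s * pinney_op v - 4" 0] by simp
  then have "of_real s * pinney_op v = 4" by simp
  moreover have "(of_real s :: germ) * of_real s = 1" using v(1) by auto
  ultimately have pv: "pinney_op v = of_real (4 * s)"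
    by (metis mult.assoc mult.commute mult_1 of_real_mult of_real_numeral)
  have "sym_op v = 0"
    by (rule sym_op_pinney[OF v(2) \<open>v \<noteq> 0\<close> pv[unfolded pinney_op_def]])
  with sym_op_kernel v(2) obtain c where c: "v = of_real c * w" by blast
  have d: "\<partial> (of_real c * w) = of_real c * \<partial> w" "\<partial> (of_real c * \<partial> w) = of_real c * \<partial> (\<partial> w)"
    using w_mem deriv_mem by (simp_all only: deriv_real_mult)
  have "pinney_op v = of_real (c * c) * pinney_op w"
    unfolding pinney_op_def c d by (simp add: power2_eq_square algebra_simps)
  also have "\<dots> = of_real (4 * (c * c))" using pinney by (simp add: pinney_op_def)
  finally have cs: "c * c = s" using pv of_real_eq_iff[of "4 * s" "4 * (c * c)", where 'a = germ] by simp
  then have "s = 1" using v(1) zero_le_square[of c] by auto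
  then show ?thesis using v(3) c cs
    by (metis of_real_1 mult_1 power_mult_distrib of_real_mult power2_eq_square)
qed

lemma square_op_w: "square_op (w\<^sup>2) = 0"
  using square_op_square[OF w_mem, of 1] pinney by (simp add: pinney_op_def)

section \<open>Algebraic extensions\<close>

lemma deriv_power: "w * \<partial> (w ^ k) = of_nat k * w ^ k * \<partial> w"
proof (induction k)
  case (Suc k)
  have "w * \<partial> (w ^ Suc k) = \<partial> w * w * w ^ k + w * (w * \<partial> (w ^ k))"
    using w_mem by (simp add: deriv_mult closed_deriv algebra_simps)
  then show ?case unfolding Suc by (simp add: algebra_simps)
qed simp

text \<open>
  The logarithmic derivative \<open>g = w'/w\<close> is \<open>1/k\<close> times that of \<open>w\<^sup>k\<close>, so it lies in \<open>F\<close>; and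
  Pinney's equation reads \<open>w\<^sup>2 (2(g\<^sup>2 + g') - g\<^sup>2 + 4f) = 4\<close>.
\<close>
lemma square_mem_of_power_mem:
  assumes "hardy_field F" "f \<in> F" "w ^ k \<in> F" "k > 0"
  shows "w\<^sup>2 \<in> F"
proof -
  interpret F: hardy_field F by fact
  define g where "g = p * \<partial> w"
  have wg: "w * g = \<partial> w" unfolding g_def using phase_deriv by (metis mult.assoc mult.commute mult_1)
  have gL: "g \<in> L" unfolding g_def by (intro mult_mem p_mem deriv_mem w_mem)
  have wk: "w ^ k \<noteq> 0" using w_mem w_nonzero power_nonzero by blast
  have "w * \<partial> (w ^ k) = w * (g * (of_nat k * w ^ k))"
    unfolding deriv_power wg[symmetric] by (simp add: algebra_simps)
  then have "g * (of_nat k * w ^ k) = \<partial> (w ^ k)"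
    using cancel[OF w_mem w_nonzero] by simp
  moreover have "of_nat k * w ^ k \<noteq> 0"
    using assms(4) wk of_nat_mem by (intro mult_nonzero) auto
  ultimately have g: "g \<in> F"
    using F.quotient_mem F.deriv_mem[OF assms(3)] F.mult_mem[OF F.of_nat_mem assms(3)] by blast
  have d2: "\<partial> (\<partial> w) = w * g * g + w * \<partial> g"
    using deriv_mult[OF w_mem gL] unfolding wg by (simp add: wg)
  have "2 * w * \<partial> (\<partial> w) - (\<partial> w)\<^sup>2 + 4 * f * w\<^sup>2 = w\<^sup>2 * (2 * (g * g + \<partial> g) - g * g + 4 * f)"
    unfolding d2 unfolding wg[symmetric] by (simp add: power2_eq_square algebra_simps)
  then have *: "w\<^sup>2 * (2 * (g * g + \<partial> g) - g * g + 4 * f) = 4" unfolding pinney by simp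
  then have "2 * (g * g + \<partial> g) - g * g + 4 * f \<noteq> 0" by auto
  moreover have "2 * (g * g + \<partial> g) - g * g + 4 * f \<in> F"
    using g assms(2) by (intro F.closed_deriv F.numeral_mem)
  ultimately show ?thesis using F.quotient_mem[OF * F.numeral_mem] by blast
qed

text \<open>
  The powers of the matrix \<open>M\<close> of multiplication by \<open>w\<close> on \<open>F(w)\<close> have traces in \<open>F\<close> of the form
  \<open>c\<^sub>k w\<^sup>k\<close> with real \<open>c\<^sub>k\<close>. They cannot vanish for all \<open>k > 0\<close>: otherwise, taking the trace of the
  minimal equation \<open>w\<^sup>n = a\<^sub>0 + a\<^sub>1 w + \<dots>\<close> would give \<open>0 = n a\<^sub>0\<close>, whereas \<open>a\<^sub>0 \<noteq> 0\<close> by minimality.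
\<close>
lemma square_mem_of_algebraic:
  assumes "hardy_field F" "F \<subseteq> L" "\<real> \<subseteq> F" "f \<in> F" "algebraic_over F w"
  shows "w\<^sup>2 \<in> F"
proof -
  interpret hardy_extension F L
    using assms(1,2) hardy_field_axioms by (simp add: hardy_extension_def hardy_extension_axioms_def)
  obtain n a where basis: "power_basis F w n a"
    using algebraic_basis[OF w_mem assms(5)] by blast
  have n: "n > 0" and a: "\<And>i. a i \<in> F" "w ^ n = (\<Sum>i<n. a i * w ^ i)"
    and indep: "\<And>c i. \<forall>i. c i \<in> F \<Longrightarrow> (\<Sum>i<n. c i * w ^ i) = 0 \<Longrightarrow> i < n \<Longrightarrow> c i = 0"
    using basis unfolding power_basis_def by simp_all
  interpret A: hardy_field "adjoin F w"
    using hardy_adjoin[OF w_mem deriv_algebraic_mem_adjoin[OF w_mem assms(5)]] .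
  have wA: "w \<in> adjoin F w" by (rule mem_adjoin)
  have coords: "\<exists>X. (\<forall>i j. X i j \<in> F) \<and> (\<forall>i. y i = (\<Sum>j<n. X i j * w ^ j))"
    if "\<And>i. y i \<in> adjoin F w" for y :: "nat \<Rightarrow> germ"
    using algebraic_adjoin[OF w_mem basis that] by metis
  \<comment> \<open>\<open>X\<close> is the matrix of multiplication by \<open>x\<close>\<close>
  define rep where "rep X x \<longleftrightarrow> (\<forall>i j. X i j \<in> F) \<and> (\<forall>i<n. x * w ^ i = (\<Sum>j<n. X i j * w ^ j))"
    for X :: gmat and x
  have rep_unique: "X i j = Y i j" if "rep X x" "rep Y x" "i < n" "j < n" for X Y x i j
  proof -
    have "(\<Sum>j<n. (X i j - Y i j) * w ^ j) = 0"
      using that by (simp add: rep_def left_diff_distrib sum_subtractf)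
    moreover have "\<forall>j. X i j - Y i j \<in> F" using that by (auto simp: rep_def intro: F.closed)
    ultimately show ?thesis using indep[of "\<lambda>j. X i j - Y i j" j] that by simp
  qed
  obtain \<Gamma> where \<Gamma>: "\<And>i j. \<Gamma> i j \<in> F" "\<And>i. \<partial> (w ^ i) = (\<Sum>j<n. \<Gamma> i j * w ^ j)"
    using coords[of "\<lambda>i. \<partial> (w ^ i)"] A.deriv_mem[OF A.power_mem[OF wA]] by blast
  obtain M where M: "rep M w"
    using coords[of "\<lambda>i. w * w ^ i"] A.mult_mem[OF wA A.power_mem[OF wA]] unfolding rep_def by blast
  have rep_deriv: "rep (cov_deriv n \<Gamma> X) (\<partial> x)" if X: "rep X x" and x: "x \<in> L" for X x
  proof -
    have XF: "X i j \<in> F" for i j using X by (simp add: rep_def)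
    then have XL: "X i j \<in> L" for i j using subset by blast
    have "\<partial> x * w ^ i = (\<Sum>j<n. cov_deriv n \<Gamma> X i j * w ^ j)" if i: "i < n" for i
    proof -
      have "\<partial> (x * w ^ i) = \<partial> x * w ^ i + (\<Sum>k<n. \<Gamma> i k * (x * w ^ k))"
        using x w_mem by (simp add: deriv_mult power_mem \<Gamma>(2) sum_distrib_left mult.left_commute)
      also have "(\<Sum>k<n. \<Gamma> i k * (x * w ^ k)) = (\<Sum>k<n. \<Sum>j<n. \<Gamma> i k * X k j * w ^ j)"
        using X by (simp add: rep_def sum_distrib_left mult.assoc)
      also have "\<dots> = (\<Sum>j<n. mprod n \<Gamma> X i j * w ^ j)"
        by (subst sum.swap) (simp add: mprod_def sum_distrib_right)
      finally have 1: "\<partial> (x * w ^ i) = \<partial> x * w ^ i + (\<Sum>j<n. mprod n \<Gamma> X i j * w ^ j)" .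
      have "\<partial> (x * w ^ i) = (\<Sum>k<n. \<partial> (X i k * w ^ k))"
        using X i XL w_mem by (simp add: rep_def deriv_sum closed)
      also have "\<dots> = (\<Sum>k<n. \<partial> (X i k) * w ^ k) + (\<Sum>k<n. \<Sum>j<n. X i k * \<Gamma> k j * w ^ j)"
        using XL w_mem by (simp add: deriv_mult power_mem sum.distrib \<Gamma>(2) sum_distrib_left mult.assoc)
      also have "(\<Sum>k<n. \<Sum>j<n. X i k * \<Gamma> k j * w ^ j) = (\<Sum>j<n. mprod n X \<Gamma> i j * w ^ j)"
        by (subst sum.swap) (simp add: mprod_def sum_distrib_right)
      finally show ?thesis
        using 1 by (simp add: cov_deriv_def left_diff_distrib distrib_right sum.distrib sum_subtractf
            algebra_simps)
    qed
    moreover have "cov_deriv n \<Gamma> X i j \<in> F" for i j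
      using XF \<Gamma>(1) by (auto simp: cov_deriv_def mprod_def intro!: F.closed_deriv)
    ultimately show ?thesis by (simp add: rep_def)
  qed
  have wL: "w \<in> L" "\<partial> w \<in> L" "\<partial> (\<partial> w) \<in> L" using w_mem deriv_mem by auto
  note D = rep_deriv[OF M wL(1)]
  note D2 = rep_deriv[OF D wL(2)]
  note D3 = rep_deriv[OF D2 wL(3)]
  have sol: "sym_solution n \<Gamma> M"
  proof -
    let ?D = "cov_deriv n \<Gamma>"
    let ?Z = "\<lambda>i j. ?D (?D (?D M)) i j + 4 * f * ?D M i j + 2 * \<partial> f * M i j"
    have "(\<Sum>j<n. ?Z i j * w ^ j) = sym_op w * w ^ i" if "i < n" for i
      using D D3 M that
      by (simp add: rep_def sym_op_def distrib_right sum.distrib mult.assoc flip: sum_distrib_left)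
    moreover have "?Z i j \<in> F" for i j
      using D D3 M assms(4) by (auto simp: rep_def intro!: F.closed_deriv)
    ultimately have "rep ?Z 0" by (simp add: rep_def sym_op_w)
    moreover have "rep (\<lambda>i j. 0) 0" by (simp add: rep_def)
    ultimately show ?thesis
      using rep_unique[of ?Z 0 "\<lambda>i j. 0"] by (simp add: sym_solution_def)
  qed
  have smooth_entries: "smooth_mat X" if "\<And>i j. X i j \<in> F" for X
    using that F.smooth by (auto simp: smooth_mat_def)
  define P where "P k = (mprod n M ^^ k) ident" for k
  have P: "rep (P k) (w ^ k)" for k
  proof (induction k)
    case 0
    have "(\<Sum>j<n. ident i j * w ^ j) = w ^ i" if "i < n" for i
    proof -
      have "ident i j * w ^ j = (if i = j then w ^ j else 0)" for j by (simp add: ident_def)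
      then show ?thesis using that by simp
    qed
    then show ?case by (simp add: rep_def P_def) (simp add: ident_def)
  next
    case (Suc k)
    have "w ^ Suc k * w ^ i = (\<Sum>j<n. mprod n M (P k) i j * w ^ j)" if "i < n" for i
    proof -
      have "w ^ Suc k * w ^ i = w ^ k * (\<Sum>l<n. M i l * w ^ l)"
        using M that unfolding rep_def by (metis mult.assoc mult.commute power_Suc)
      also have "\<dots> = (\<Sum>l<n. M i l * (w ^ k * w ^ l))"
        by (simp add: sum_distrib_left mult.left_commute)
      also have "\<dots> = (\<Sum>l<n. \<Sum>j<n. M i l * P k l j * w ^ j)"
        using Suc by (simp add: rep_def sum_distrib_left mult.assoc)
      also have "\<dots> = (\<Sum>j<n. mprod n M (P k) i j * w ^ j)"
        by (subst sum.swap) (simp add: mprod_def sum_distrib_right)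
      finally show ?thesis .
    qed
    moreover have "mprod n M (P k) i j \<in> F" for i j
      using M Suc by (auto simp: rep_def mprod_def intro!: F.closed)
    ultimately show ?case by (simp add: rep_def P_def)
  qed
  have trF: "mtrace n (P k) \<in> F" for k
    using P[of k] by (auto simp: mtrace_def rep_def intro!: F.closed)
  have a0: "a 0 \<noteq> 0"
  proof
    assume "a 0 = 0"
    obtain m where m: "n = Suc m" using n by (cases n) auto
    have "w * w ^ m = w * (\<Sum>i<m. a (Suc i) * w ^ i)"
      using a(2) \<open>a 0 = 0\<close> unfolding m
      by (simp add: sum.lessThan_Suc_shift sum_distrib_left mult.left_commute del: sum.lessThan_Suc)
    then have *: "w ^ m = (\<Sum>i<m. a (Suc i) * w ^ i)"
      using cancel[OF w_mem w_nonzero] by blast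
    \<comment> \<open>dividing the minimal equation by \<open>w\<close> gives a shorter one\<close>
    define c where "c i = (if i = m then 1 else - a (Suc i))" for i
    have "(\<Sum>i<n. c i * w ^ i) = 0"
      using * by (simp add: m c_def sum_negf)
    moreover have "\<forall>i. c i \<in> F" using a(1) by (auto simp: c_def intro: F.closed)
    ultimately have "c m = 0" using indep[of c m] m by simp
    then show False by (simp add: c_def)
  qed
  have "\<exists>k. k > 0 \<and> mtrace n (P k) \<noteq> 0"
  proof (rule ccontr)
    assume "\<not> ?thesis"
    then have zero: "mtrace n (P k) = 0" if "k > 0" for k using that by blast
    have "rep (\<lambda>i j. \<Sum>k<n. a k * P k i j) (w ^ n)"
    proof -
      have "w ^ n * w ^ i = (\<Sum>j<n. (\<Sum>k<n. a k * P k i j) * w ^ j)" if "i < n" for i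
      proof -
        have "w ^ n * w ^ i = (\<Sum>k<n. a k * (w ^ k * w ^ i))"
          unfolding a(2) by (simp add: sum_distrib_right mult.assoc)
        also have "\<dots> = (\<Sum>k<n. \<Sum>j<n. a k * P k i j * w ^ j)"
          using P that by (simp add: rep_def sum_distrib_left mult.assoc)
        also have "\<dots> = (\<Sum>j<n. (\<Sum>k<n. a k * P k i j) * w ^ j)"
          by (subst sum.swap) (simp add: sum_distrib_right)
        finally show ?thesis .
      qed
      moreover have "(\<Sum>k<n. a k * P k i j) \<in> F" for i j
        using a(1) P by (auto simp: rep_def intro!: F.closed)
      ultimately show ?thesis by (simp add: rep_def)
    qed
    then have "mtrace n (P n) = (\<Sum>i<n. \<Sum>k<n. a k * P k i i)"
      using rep_unique[OF P] by (simp add: mtrace_def)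
    also have "\<dots> = (\<Sum>k<n. a k * mtrace n (P k))"
      by (subst sum.swap) (simp add: mtrace_def sum_distrib_left)
    also have "\<dots> = (\<Sum>k<n. if k = 0 then a 0 * mtrace n (P 0) else 0)"
      using zero by (intro sum.cong) auto
    also have "\<dots> = a 0 * of_nat n"
      using n by (simp add: mtrace_def P_def ident_def)
    finally have "a 0 * of_nat n = 0" using zero[OF n] by simp
    then show False using F.mult_nonzero[OF a(1) a0, of "of_nat n"] n by simp
  qed
  then obtain k where k: "k > 0" "mtrace n (P k) \<noteq> 0" by blast
  have "smooth_mat \<Gamma>" "smooth_mat M"
    using \<Gamma>(1) M by (auto simp: rep_def intro: smooth_entries)
  then have "\<exists>c. mtrace n (P k) = of_real c * w ^ k"
    unfolding P_def by (rule trace_power_constant[OF _ _ sol]) (use trF[of k] subset P_def in auto)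
  then obtain c where c: "mtrace n (P k) = of_real c * w ^ k" ..
  have "c \<noteq> 0" using k(2) c by auto
  have eq: "w ^ k * of_real c = mtrace n (P k)" unfolding c by (simp add: mult.commute)
  have nz: "of_real c \<noteq> (0 :: germ)" using \<open>c \<noteq> 0\<close> by simp
  have mem: "of_real c \<in> F" using assms(3) Reals_of_real by blast
  have "w ^ k \<in> F" by (rule F.quotient_mem[OF eq trF mem nz])
  then show ?thesis using square_mem_of_power_mem[OF assms(1,4)] k(1) by simp
qed

end

section \<open>Transcendental extensions by integrals and exponentials\<close>

context phase
begin

text \<open>
  The numerator of \<open>square_op (a/b)\<close>, as a polynomial in \<open>a\<close>, \<open>b\<close> and their first two derivatives.
\<close>
definition square_num :: "germ \<Rightarrow> germ \<Rightarrow> germ \<Rightarrow> germ \<Rightarrow> germ \<Rightarrow> germ \<Rightarrow> germ" where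
  "square_num a a1 a2 b b1 b2 =
     4 * a * ((a2 * b - a * b2) * b - 2 * b1 * (a1 * b - a * b1))
     - 3 * (a1 * b - a * b1)\<^sup>2 + 16 * f * a\<^sup>2 * b\<^sup>2 - 16 * a * b ^ 3"

lemma square_op_quotient:
  assumes "V \<in> L" "b \<in> L" "V * b = a"
  shows "b ^ 4 * square_op V = square_num a (\<partial> a) (\<partial> (\<partial> a)) b (\<partial> b) (\<partial> (\<partial> b))"
proof -
  have a1: "\<partial> a = \<partial> V * b + V * \<partial> b"
    using assms by (auto simp: deriv_mult)
  have a2: "\<partial> (\<partial> a) = \<partial> (\<partial> V) * b + 2 * (\<partial> V * \<partial> b) + V * \<partial> (\<partial> b)"
    unfolding a1 using assms by (simp add: deriv_mult deriv_add closed_deriv algebra_simps)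
  show ?thesis
    unfolding square_num_def square_op_def a2 unfolding a1 unfolding assms(3)[symmetric]
    by (simp add: power2_eq_square power3_eq_cube power4_eq_xxxx algebra_simps)
qed

text \<open>
  The pairs \<open>(\<alpha>, \<beta>) \<in> S\<close> stand for substitutions \<open>t \<mapsto> \<alpha> + \<beta>t\<close>. They commute with the derivation in
  the sense that one polynomial \<open>q'\<close> describes the derivative of \<open>q\<close> at all the
  points \<open>\<alpha> + \<beta>t\<close>. With \<open>w\<^sup>2 = A(t)/B(t)\<close>, the equation for \<open>w\<^sup>2\<close> becomes a polynomial
  equation for \<open>t\<close>, hence an identity since \<open>t\<close> is transcendental, and so it holds for
  \<open>A(\<alpha> + \<beta>t)/B(\<alpha> + \<beta>t)\<close>. By uniqueness this germ is \<open>w\<^sup>2\<close> again. Therefore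
  \<open>A(\<alpha> + \<beta>X) B(X) = A(X) B(\<alpha> + \<beta>X)\<close>, and inserting a real \<open>x\<close> for \<open>X\<close> shows that \<open>A\<close> is a multiple of
  \<open>B\<close> because \<open>\<alpha> + \<beta>x\<close> takes infinitely many values.
\<close>
lemma square_mem_of_substitution:
  assumes F: "hardy_field F" "F \<subseteq> L" "\<real> \<subseteq> F" "f \<in> F" and t: "t \<in> L" "\<not> algebraic_over F t"
    and S: "(0, 1) \<in> S" "\<And>\<alpha> \<beta>. (\<alpha>, \<beta>) \<in> S \<Longrightarrow> \<beta> \<noteq> (0 :: real)"
      "\<And>x. x > 0 \<Longrightarrow> infinite ((\<lambda>(\<alpha>, \<beta>). \<alpha> + \<beta> * x) ` S)"
    and deriv: "\<And>q. over F q \<Longrightarrow> \<exists>q'. over F q' \<and> (\<forall>(\<alpha>, \<beta>)\<in>S.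
        \<partial> (poly q (of_real \<alpha> + of_real \<beta> * t)) = poly q' (of_real \<alpha> + of_real \<beta> * t))"
    and sqrt: "\<And>g. g \<in> L \<Longrightarrow> g > 0 \<Longrightarrow> \<exists>h\<in>L. h\<^sup>2 = g"
    and mem: "w\<^sup>2 \<in> adjoin F t"
  shows "w\<^sup>2 \<in> F"
proof -
  interpret hardy_extension F L
    using assms(1,2) hardy_field_axioms by (simp add: hardy_extension_def hardy_extension_axioms_def)
  have realF: "of_real c \<in> F" for c using F(3) Reals_of_real by blast
  obtain A B where AB: "over F A" "over F B" "poly B t \<noteq> 0" "w\<^sup>2 * poly B t = poly A t"
    using mem unfolding adjoin_def by blast
  have zero: "q = 0" if "over F q" "poly q t = 0" for q
    using t(2) that unfolding algebraic_over_def by blast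
  have w2: "w\<^sup>2 \<in> L" "w\<^sup>2 \<noteq> 0"
    using w_mem w_nonzero power_mem power_nonzero by blast+
  define s where "s \<alpha> \<beta> = of_real \<alpha> + of_real \<beta> * t" for \<alpha> \<beta> :: real
  have sL: "s \<alpha> \<beta> \<in> L" for \<alpha> \<beta>
    unfolding s_def using t(1) by (intro closed of_real_mem)
  have s01: "s 0 1 = t" by (simp add: s_def)
  have subst: "poly (pcompose q [:of_real \<alpha>, of_real \<beta>:]) t = poly q (s \<alpha> \<beta>)" for q \<alpha> \<beta>
    by (simp add: poly_pcompose s_def mult.commute)
  have over_subst: "over F (pcompose q [:of_real \<alpha>, of_real \<beta>:])" if "over F q" for q \<alpha> \<beta>
    using that realF by (intro F.over_pcompose) auto
  have nonzero: "poly q (s \<alpha> \<beta>) \<noteq> 0" if "over F q" "q \<noteq> 0" "\<beta> \<noteq> 0" for q \<alpha> \<beta>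
  proof
    assume "poly q (s \<alpha> \<beta>) = 0"
    then have "pcompose q [:of_real \<alpha>, of_real \<beta>:] = 0"
      using zero over_subst[OF that(1)] subst by simp
    then have "pcompose (pcompose q [:of_real \<alpha>, of_real \<beta>:]) [:of_real (- \<alpha> / \<beta>), of_real (1 / \<beta>):] = 0"
      by simp
    moreover have "pcompose [:of_real \<alpha>, of_real \<beta>:] [:of_real (- \<alpha> / \<beta>), of_real (1 / \<beta>):] = ([:0, 1:] :: germ poly)"
      using that(3) by (simp add: pcompose_pCons flip: of_real_mult of_real_add)
    ultimately have "q = 0" by (metis pcompose_assoc pcompose_idR)
    with that(2) show False ..
  qed
  have "B \<noteq> 0" using AB(3) by auto
  obtain A1 A2 B1 B2 where D: "over F A1" "over F A2" "over F B1" "over F B2"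
    and d: "\<And>\<alpha> \<beta>. (\<alpha>, \<beta>) \<in> S \<Longrightarrow> \<partial> (poly A (s \<alpha> \<beta>)) = poly A1 (s \<alpha> \<beta>)"
      "\<And>\<alpha> \<beta>. (\<alpha>, \<beta>) \<in> S \<Longrightarrow> \<partial> (poly A1 (s \<alpha> \<beta>)) = poly A2 (s \<alpha> \<beta>)"
      "\<And>\<alpha> \<beta>. (\<alpha>, \<beta>) \<in> S \<Longrightarrow> \<partial> (poly B (s \<alpha> \<beta>)) = poly B1 (s \<alpha> \<beta>)"
      "\<And>\<alpha> \<beta>. (\<alpha>, \<beta>) \<in> S \<Longrightarrow> \<partial> (poly B1 (s \<alpha> \<beta>)) = poly B2 (s \<alpha> \<beta>)"
  proof -
    have ex: "\<exists>q'. over F q' \<and> (\<forall>\<alpha> \<beta>. (\<alpha>, \<beta>) \<in> S \<longrightarrow> \<partial> (poly q (s \<alpha> \<beta>)) = poly q' (s \<alpha> \<beta>))"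
      if "over F q" for q
      using deriv[OF that] unfolding s_def by fast
    obtain A1 where A1: "over F A1" "\<forall>\<alpha> \<beta>. (\<alpha>, \<beta>) \<in> S \<longrightarrow> \<partial> (poly A (s \<alpha> \<beta>)) = poly A1 (s \<alpha> \<beta>)"
      using ex[OF AB(1)] by blast
    obtain A2 where A2: "over F A2" "\<forall>\<alpha> \<beta>. (\<alpha>, \<beta>) \<in> S \<longrightarrow> \<partial> (poly A1 (s \<alpha> \<beta>)) = poly A2 (s \<alpha> \<beta>)"
      using ex[OF A1(1)] by blast
    obtain B1 where B1: "over F B1" "\<forall>\<alpha> \<beta>. (\<alpha>, \<beta>) \<in> S \<longrightarrow> \<partial> (poly B (s \<alpha> \<beta>)) = poly B1 (s \<alpha> \<beta>)"
      using ex[OF AB(2)] by blast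
    obtain B2 where B2: "over F B2" "\<forall>\<alpha> \<beta>. (\<alpha>, \<beta>) \<in> S \<longrightarrow> \<partial> (poly B1 (s \<alpha> \<beta>)) = poly B2 (s \<alpha> \<beta>)"
      using ex[OF B1(1)] by blast
    show thesis using that[OF A1(1) A2(1) B1(1) B2(1)] A1(2) A2(2) B1(2) B2(2) by simp
  qed
  \<comment> \<open>\<open>square_num\<close> at the level of polynomials\<close>
  define R where "R = 4 * A * ((A2 * B - A * B2) * B - 2 * B1 * (A1 * B - A * B1))
     - 3 * (A1 * B - A * B1)\<^sup>2 + 16 * [:f:] * A\<^sup>2 * B\<^sup>2 - 16 * A * B ^ 3"
  have R_over: "over F R"
    unfolding R_def using AB D F(4) by (intro F.over_closed) auto
  have R: "poly R x = square_num (poly A x) (poly A1 x) (poly A2 x) (poly B x) (poly B1 x) (poly B2 x)" for x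
    unfolding R_def square_num_def by simp
  have "poly R t = poly B t ^ 4 * square_op (w\<^sup>2)"
    using square_op_quotient[OF w2(1) poly_mem[OF AB(2) t(1)] AB(4)] d[OF S(1)] unfolding s01 R by simp
  then have "poly R t = 0" by (simp add: square_op_w)
  with zero R_over have R0: "R = 0" by blast
  have invariant: "w\<^sup>2 * poly B (s \<alpha> \<beta>) = poly A (s \<alpha> \<beta>)" if "(\<alpha>, \<beta>) \<in> S" for \<alpha> \<beta>
  proof -
    have mems: "poly A (s \<alpha> \<beta>) \<in> L" "poly B (s \<alpha> \<beta>) \<in> L"
      using poly_mem AB sL by blast+
    have nz: "poly B (s \<alpha> \<beta>) \<noteq> 0" "poly A (s \<alpha> \<beta>) \<noteq> 0"
    proof -
      show "poly B (s \<alpha> \<beta>) \<noteq> 0" using nonzero[OF AB(2) \<open>B \<noteq> 0\<close> S(2)[OF that]] .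
      have "poly A t \<noteq> 0" using mult_nonzero[OF w2 AB(3)] AB(4) by simp
      then have "A \<noteq> 0" by auto
      then show "poly A (s \<alpha> \<beta>) \<noteq> 0" using nonzero[OF AB(1) _ S(2)[OF that]] by blast
    qed
    obtain r where r: "r \<in> L" "poly B (s \<alpha> \<beta>) * r = 1" using inverse_mem[OF mems(2) nz(1)] by blast
    define V where "V = poly A (s \<alpha> \<beta>) * r"
    have VL: "V \<in> L" unfolding V_def using mems(1) r(1) by (rule mult_mem)
    have VB: "V * poly B (s \<alpha> \<beta>) = poly A (s \<alpha> \<beta>)"
      unfolding V_def using r(2) by (metis mult.assoc mult.commute mult_1_right)
    have "V \<noteq> 0" using VB nz(2) by auto
    have "poly B (s \<alpha> \<beta>) ^ 4 * square_op V = poly R (s \<alpha> \<beta>)"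
      using square_op_quotient[OF VL mems(2) VB] unfolding R d[OF that] .
    then have "poly B (s \<alpha> \<beta>) ^ 4 * square_op V = poly B (s \<alpha> \<beta>) ^ 4 * 0" by (simp add: R0)
    then have "square_op V = 0"
      using cancel[OF power_mem[OF mems(2)] power_nonzero[OF mems(2) nz(1)]] by blast
    with square_unique[OF sqrt VL \<open>V \<noteq> 0\<close>] have "V = w\<^sup>2" by blast
    with VB show ?thesis by simp
  qed
  have identity: "poly A (of_real (\<alpha> + \<beta> * x)) * poly B (of_real x) =
      poly A (of_real x) * poly B (of_real (\<alpha> + \<beta> * x))" if "(\<alpha>, \<beta>) \<in> S" for \<alpha> \<beta> and x :: real
  proof -
    define q where "q = pcompose A [:of_real \<alpha>, of_real \<beta>:] * B - A * pcompose B [:of_real \<alpha>, of_real \<beta>:]"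
    have "over F q" unfolding q_def by (intro F.over_closed over_subst AB)
    moreover have "poly q t = 0"
      unfolding q_def using invariant[OF that] AB(4) subst
      by (simp flip: invariant[OF that] AB(4))
    ultimately have "poly q (of_real x) = 0" using zero[of q] by simp
    then show ?thesis by (simp add: q_def poly_pcompose mult.commute)
  qed
  have "\<not> {0<..} \<subseteq> {x :: real. poly B (of_real x) = 0}"
    using finite_real_roots[OF \<open>B \<noteq> 0\<close>] infinite_Ioi[of "0 :: real"] finite_subset by blast
  then obtain x :: real where x: "x > 0" "poly B (of_real x) \<noteq> 0" by auto
  define q where "q = smult (poly B (of_real x)) A - smult (poly A (of_real x)) B"
  have "(\<lambda>(\<alpha>, \<beta>). \<alpha> + \<beta> * x) ` S \<subseteq> {y. poly q (of_real y) = 0}"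
    using identity by (auto simp: q_def mult.commute)
  then have "infinite {y :: real. poly q (of_real y) = 0}"
    using S(3)[OF x(1)] finite_subset by blast
  then have "q = 0" using finite_real_roots by blast
  then have "poly q t = 0" by simp
  then have "poly B t * (w\<^sup>2 * poly B (of_real x)) = poly B t * poly A (of_real x)"
    using AB(4) by (simp add: q_def algebra_simps flip: AB(4))
  then have "w\<^sup>2 * poly B (of_real x) = poly A (of_real x)"
    using cancel[OF poly_mem[OF AB(2) t(1)] AB(3)] by blast
  then show ?thesis
    using F.quotient_mem F.poly_mem AB realF x(2) by blast
qed

lemma square_mem_of_primitive:
  assumes F: "hardy_field F" "F \<subseteq> L" "\<real> \<subseteq> F" "f \<in> F" and t: "t \<in> L" "\<not> algebraic_over F t"
    and b: "b \<in> F" "\<partial> t = b"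
    and sqrt: "\<And>g. g \<in> L \<Longrightarrow> g > 0 \<Longrightarrow> \<exists>h\<in>L. h\<^sup>2 = g"
    and mem: "w\<^sup>2 \<in> adjoin F t"
  shows "w\<^sup>2 \<in> F"
proof (rule square_mem_of_substitution[OF F t _ _ _ _ sqrt mem, where S = "range (\<lambda>c. (c, 1))"])
  interpret hardy_extension F L
    using F(1,2) hardy_field_axioms by (simp add: hardy_extension_def hardy_extension_axioms_def)
  fix q assume "over F q"
  then show "\<exists>q'. over F q' \<and> (\<forall>(\<alpha>, \<beta>)\<in>range (\<lambda>c. (c, 1)).
        \<partial> (poly q (of_real \<alpha> + of_real \<beta> * t)) = poly q' (of_real \<alpha> + of_real \<beta> * t))"
  proof (induction q)
    case 0
    show ?case by (intro exI[of _ 0]) simp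
  next
    case (pCons a q)
    then obtain q' where q': "over F q'" "\<And>c. \<partial> (poly q (of_real c + t)) = poly q' (of_real c + t)" by auto
    have a: "a \<in> F" "over F q" using pCons.prems by auto
    have "\<partial> (poly (pCons a q) (of_real c + t)) = poly (pCons (\<partial> a) q' + smult b q) (of_real c + t)" for c
    proof -
      have m: "of_real c + t \<in> L" "poly q (of_real c + t) \<in> L" "a \<in> L"
        using a t(1) subset by (auto intro!: closed poly_mem)
      have "\<partial> (of_real c + t) = b" using deriv_add[of "of_real c" t] t(1) b by simp
      then show ?thesis using m by (simp add: deriv_add deriv_mult mult_mem q'(2))
    qed
    moreover have "over F (pCons (\<partial> a) q' + smult b q)"
      using a q'(1) b(1) F.deriv_mem by (intro F.over_closed) auto
    ultimately show ?case by auto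
  qed
next
  fix x :: real
  have "(\<lambda>(\<alpha>, \<beta>). \<alpha> + \<beta> * x) ` range (\<lambda>c. (c, 1)) = UNIV"
    by (auto simp: image_image intro!: surjI[of _ "\<lambda>y. y - x"])
  then show "infinite ((\<lambda>(\<alpha>, \<beta>). \<alpha> + \<beta> * x) ` range (\<lambda>c. (c, 1)))"
    by (simp add: infinite_UNIV_char_0)
qed auto

lemma square_mem_of_exponential:
  assumes F: "hardy_field F" "F \<subseteq> L" "\<real> \<subseteq> F" "f \<in> F" and t: "t \<in> L" "\<not> algebraic_over F t"
    and b: "b \<in> F" "\<partial> t = t * b"
    and sqrt: "\<And>g. g \<in> L \<Longrightarrow> g > 0 \<Longrightarrow> \<exists>h\<in>L. h\<^sup>2 = g"
    and mem: "w\<^sup>2 \<in> adjoin F t"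
  shows "w\<^sup>2 \<in> F"
proof (rule square_mem_of_substitution[OF F t _ _ _ _ sqrt mem, where S = "Pair 0 ` {0<..}"])
  interpret hardy_extension F L
    using F(1,2) hardy_field_axioms by (simp add: hardy_extension_def hardy_extension_axioms_def)
  fix q assume "over F q"
  then show "\<exists>q'. over F q' \<and> (\<forall>(\<alpha>, \<beta>)\<in>Pair 0 ` {0<..}.
        \<partial> (poly q (of_real \<alpha> + of_real \<beta> * t)) = poly q' (of_real \<alpha> + of_real \<beta> * t))"
  proof (induction q)
    case 0
    show ?case by (intro exI[of _ 0]) simp
  next
    case (pCons a q)
    then obtain q' where q': "over F q'" "\<And>c. c > 0 \<Longrightarrow> \<partial> (poly q (of_real c * t)) = poly q' (of_real c * t)"
      by auto
    have a: "a \<in> F" "over F q" using pCons.prems by auto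
    have "\<partial> (poly (pCons a q) (of_real c * t)) = poly (pCons (\<partial> a) (q' + smult b q)) (of_real c * t)"
      if "c > 0" for c
    proof -
      have m: "of_real c * t \<in> L" "poly q (of_real c * t) \<in> L" "a \<in> L"
        using a t(1) subset by (auto intro!: closed poly_mem)
      have "\<partial> (of_real c * t) = of_real c * t * b"
        using t(1) b by (simp add: deriv_real_mult mult.assoc)
      moreover have "\<partial> (a + of_real c * t * poly q (of_real c * t)) = \<partial> a +
          (\<partial> (of_real c * t) * poly q (of_real c * t) + of_real c * t * \<partial> (poly q (of_real c * t)))"
        using m by (simp only: deriv_add deriv_mult mult_mem)
      ultimately show ?thesis using q'(2)[OF that] by (simp add: algebra_simps)
    qed
    moreover have "over F (pCons (\<partial> a) (q' + smult b q))"
      using a q'(1) b(1) F.deriv_mem F.over_closed by simp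
    ultimately show ?case by (intro exI[of _ "pCons (\<partial> a) (q' + smult b q)"]) auto
  qed
next
  fix x :: real assume "x > 0"
  have "y = (y / x) * x" "y / x > 0" if "y > 0" for y using that \<open>x > 0\<close> by simp_all
  then have "{0<..} \<subseteq> (\<lambda>(\<alpha>, \<beta>). \<alpha> + \<beta> * x) ` Pair 0 ` {0<..}"
    by (force simp: image_image)
  then show "infinite ((\<lambda>(\<alpha>, \<beta>). \<alpha> + \<beta> * x) ` Pair 0 ` {0<..})"
    using infinite_Ioi[of "0 :: real"] finite_subset by blast
qed auto

end

section \<open>Descent to the ground field\<close>

text \<open>
  The hull is an intersection of subfields. It contains inverses because an inverse in the ring
  of germs is unique, so that all these subfields share it. The subfield \<open>L\<close> provides one to begin with.
\<close>
lemma germ_subfield_hull: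
  assumes "germ_subfield L" "X \<subseteq> L"
  shows "germ_subfield (germ_subfield hull X)"
proof -
  let ?H = "germ_subfield hull X"
  have sub: "?H \<subseteq> K" if "germ_subfield K" "X \<subseteq> K" for K
    unfolding hull_def using that by blast
  have mem: "x \<in> ?H" if "\<And>K. germ_subfield K \<Longrightarrow> X \<subseteq> K \<Longrightarrow> x \<in> K" for x
    using that by (simp add: hull_def)
  have "0 \<in> ?H" "1 \<in> ?H"
    by (rule mem, simp add: germ_subfield_def)+
  moreover have "g + h \<in> ?H \<and> g - h \<in> ?H \<and> g * h \<in> ?H" if gh: "g \<in> ?H" "h \<in> ?H" for g h
  proof -
    have "g + h \<in> K \<and> g - h \<in> K \<and> g * h \<in> K" if K: "germ_subfield K" "X \<subseteq> K" for K
    proof -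
      have "g \<in> K" "h \<in> K" using gh sub[OF K] by auto
      then show ?thesis using K(1) by (simp add: germ_subfield_def)
    qed
    then show ?thesis by (auto intro!: mem)
  qed
  moreover have "\<exists>h\<in>?H. g * h = 1" if g: "g \<in> ?H" "g \<noteq> 0" for g
  proof -
    have inv: "\<exists>h\<in>K. g * h = 1" if K: "germ_subfield K" "X \<subseteq> K" for K
    proof -
      have "g \<in> K" using g sub[OF K] by auto
      then show ?thesis using K(1) g(2) by (simp add: germ_subfield_def)
    qed
    obtain h where h: "g * h = 1" using inv[OF assms] by blast
    have "h \<in> K" if K: "germ_subfield K" "X \<subseteq> K" for K
    proof -
      obtain h' where "h' \<in> K" "g * h' = 1" using inv[OF K] by blast
      moreover from this h have "h' = h" by (metis mult.assoc mult.commute mult_1)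
      ultimately show ?thesis by simp
    qed
    then have "h \<in> ?H" by (rule mem)
    with h show ?thesis by blast
  qed
  ultimately show ?thesis unfolding germ_subfield_def by simp
qed

text \<open>
  The elements whose derivative stays in the field form a subfield that contains the generators.
\<close>
lemma real_diff_field_hardy:
  assumes "hardy_field L" "real_diff_field f \<subseteq> L"
  shows "hardy_field (real_diff_field f)" "\<real> \<subseteq> real_diff_field f" "f \<in> real_diff_field f"
proof -
  let ?X = "\<real> \<union> range (\<lambda>n. (\<partial> ^^ n) f)" and ?H = "real_diff_field f"
  interpret hardy_field L by fact
  have X: "?X \<subseteq> ?H" unfolding real_diff_field_def by (rule hull_subset)
  show "\<real> \<subseteq> ?H" using X by blast
  have "(\<partial> ^^ 0) f \<in> ?X" by blast
  with X show "f \<in> ?H" by auto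
  have sub: "germ_subfield ?H"
    using germ_subfield_hull[OF subfield] X assms(2) unfolding real_diff_field_def by blast
  then interpret H: germ_field ?H by unfold_locales
  define K where "K = {x \<in> ?H. \<partial> x \<in> ?H}"
  have L: "x \<in> L" if "x \<in> ?H" for x using that assms(2) by blast
  have "germ_subfield K"
  proof -
    have "\<exists>h\<in>K. g * h = 1" if g: "g \<in> K" "g \<noteq> 0" for g
    proof -
      obtain h where h: "h \<in> ?H" "g * h = 1" using H.inverse_mem g unfolding K_def by blast
      have "\<partial> (g * h) = 0" unfolding h(2) by simp
      then have "\<partial> g * h + g * \<partial> h = 0" using deriv_mult[of g h] L g h by (simp add: K_def)
      then have "g * \<partial> h = - (\<partial> g * h)" by (simp add: eq_neg_iff_add_eq_0 add.commute)
      then have "\<partial> h * g = - (\<partial> g * h)" by (simp add: mult.commute)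
      then have "\<partial> h \<in> ?H"
        using g h by (intro H.quotient_mem[of "\<partial> h" g "- (\<partial> g * h)"]) (auto simp: K_def intro!: H.closed)
      with h show ?thesis by (auto simp: K_def)
    qed
    then show ?thesis
      unfolding germ_subfield_def
      by (auto simp: K_def deriv_add deriv_diff deriv_mult L intro!: H.closed)
  qed
  moreover have "?X \<subseteq> K"
  proof
    fix x assume x: "x \<in> ?X"
    have "\<partial> x \<in> ?H"
    proof (cases "x \<in> \<real>")
      case True
      then obtain c where "x = of_real c" by (auto elim: Reals_cases)
      then show ?thesis by simp
    next
      case False
      with x obtain n where "x = (\<partial> ^^ n) f" by blast
      then have "\<partial> x = (\<partial> ^^ Suc n) f" by simp
      then have "\<partial> x \<in> ?X" by blast
      with X show ?thesis by blast
    qed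
    with x X show "x \<in> K" by (auto simp: K_def)
  qed
  ultimately have "?H \<subseteq> K" unfolding real_diff_field_def by (intro hull_minimal)
  then show "hardy_field ?H"
    using sub assms(2) smooth by unfold_locales (auto simp: K_def)
qed

context phase
begin

text \<open>
  Maximality of \<open>F\<close> turns every proper extension \<open>F(t)\<close> inside \<open>L\<close> into one that contains \<open>w\<^sup>2\<close>, and the
  results on simple extensions exclude each kind of \<open>t\<close> needed for Liouville closedness. As \<open>L\<close> already
  contains the required roots, integrals and exponentials, no extension has to be constructed.
\<close>
theorem square_mem_base:
  assumes closed: "smallest_Liouville_closed_ext H L"
    and H: "hardy_field H" "\<real> \<subseteq> H" "f \<in> H"
  shows "w\<^sup>2 \<in> H"
proof (rule ccontr)
  assume notin: "w\<^sup>2 \<notin> H"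
  have LC: "Liouville_closed L" and HL: "H \<subseteq> L"
    and least: "\<And>K. Liouville_closed K \<Longrightarrow> H \<subseteq> K \<Longrightarrow> L \<subseteq> K"
    using closed unfolding smallest_Liouville_closed_ext_def by blast+
  have RC: "real_closed L" and exp: "\<And>h. h \<in> L \<Longrightarrow> germ_comp exp h \<in> L"
    and integral: "\<And>h. h \<in> L \<Longrightarrow> \<exists>g\<in>L. g \<in> Cn 1 \<and> \<partial> g = h"
    using LC unfolding Liouville_closed_def by blast+
  have sqrt: "\<exists>h\<in>L. h\<^sup>2 = g" if "g \<in> L" "g > 0" for g
    using RC that unfolding real_closed_def by blast
  define \<A> where "\<A> = {F. hardy_field F \<and> H \<subseteq> F \<and> F \<subseteq> L \<and> w\<^sup>2 \<notin> F}"
  have "\<A> \<noteq> {}" using H HL notin by (auto simp: \<A>_def)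
  moreover have "\<Union>\<C> \<in> \<A>" if "\<C> \<noteq> {}" "subset.chain \<A> \<C>" for \<C>
  proof -
    have sub: "\<C> \<subseteq> \<A>" and chain: "\<And>A B. A \<in> \<C> \<Longrightarrow> B \<in> \<C> \<Longrightarrow> A \<subseteq> B \<or> B \<subseteq> A"
      using that(2) unfolding subset_chain_def by auto
    have "hardy_field (\<Union>\<C>)"
      by (rule hardy_field_Union[OF that(1) _ chain]) (use sub in \<open>auto simp: \<A>_def\<close>)
    then show ?thesis using that(1) sub unfolding \<A>_def by blast
  qed
  ultimately obtain F where FA: "F \<in> \<A>" and max: "\<And>K. K \<in> \<A> \<Longrightarrow> F \<subseteq> K \<Longrightarrow> K = F"
    using subset_Zorn_nonempty[of \<A>] by blast
  have F: "hardy_field F" "F \<subseteq> L" "\<real> \<subseteq> F" "f \<in> F" and HF: "H \<subseteq> F" and nF: "w\<^sup>2 \<notin> F"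
    using FA H by (auto simp: \<A>_def)
  interpret hardy_extension F L
    using F(1,2) hardy_field_axioms by (simp add: hardy_extension_def hardy_extension_axioms_def)
  have extend: "w\<^sup>2 \<in> adjoin F t" if "t \<in> L" "\<partial> t \<in> adjoin F t" "t \<notin> F" for t
  proof (rule ccontr)
    assume "w\<^sup>2 \<notin> adjoin F t"
    then have "adjoin F t \<in> \<A>"
      using hardy_adjoin[OF that(1,2)] adjoin_subset[OF that(1)] subset_adjoin[of t] HF
      by (auto simp: \<A>_def)
    then show False using max subset_adjoin[of t] mem_adjoin[of t] that(3) by blast
  qed
  have algebraic: "t \<in> F" if t: "t \<in> L" "algebraic_over F t" for t
  proof (rule ccontr)
    assume "t \<notin> F"
    then have "w\<^sup>2 \<in> adjoin F t" using extend deriv_algebraic_mem_adjoin t by blast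
    then have "algebraic_over F w"
      using algebraic_of_mem_adjoin[OF t] algebraic_over_square F.zero_mem by blast
    then show False using square_mem_of_algebraic F nF by blast
  qed
  have primitive: "t \<in> F" if t: "t \<in> L" "\<partial> t \<in> F" for t
  proof (rule ccontr)
    assume "t \<notin> F"
    moreover have "\<partial> t \<in> adjoin F t" using t(2) subset_adjoin by blast
    ultimately have "w\<^sup>2 \<in> adjoin F t" "\<not> algebraic_over F t"
      using extend t(1) algebraic by blast+
    then show False
      using square_mem_of_primitive[OF F t(1) _ t(2) refl sqrt] nF by blast
  qed
  have exponential: "t \<in> F" if t: "t \<in> L" "b \<in> F" "\<partial> t = t * b" for t b
  proof (rule ccontr)
    assume "t \<notin> F"
    moreover have "\<partial> t \<in> adjoin F t"
      unfolding t(3) using poly_mem_adjoin[of "[:0, b:]" t] t(2) by simp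
    ultimately have "w\<^sup>2 \<in> adjoin F t" "\<not> algebraic_over F t"
      using extend t(1) algebraic by blast+
    then show False
      using square_mem_of_exponential[OF F t(1) _ t(2,3) sqrt] nF by blast
  qed
  have "real_closed F"
    unfolding real_closed_def
  proof (intro conjI ballI allI impI)
    fix g assume g: "g \<in> F" "g > 0"
    then obtain h where h: "h \<in> L" "h\<^sup>2 = g" using sqrt F(2) by blast
    have "over F [:- g, 0, 1:]" using g by (simp add: F.closed)
    moreover have "poly [:- g, 0, 1:] h = 0" using h by (simp add: power2_eq_square)
    ultimately have "algebraic_over F h" unfolding algebraic_over_def by (intro exI[of _ "[:- g, 0, 1:]"]) simp
    with algebraic h show "\<exists>h\<in>F. h\<^sup>2 = g" by blast
  next
    fix q :: "germ poly" assume q: "(\<forall>i. coeff q i \<in> F) \<and> odd (degree q)"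
    then have "(\<forall>i. coeff q i \<in> L) \<and> odd (degree q)" using F(2) by blast
    then obtain g where g: "g \<in> L" "poly q g = 0" using RC unfolding real_closed_def by blast
    have "q \<noteq> 0" using q by auto
    with q g have "algebraic_over F g" unfolding algebraic_over_def over_def by blast
    with algebraic g show "\<exists>g\<in>F. poly q g = 0" by blast
  qed
  moreover have "germ_comp exp h \<in> F" if "h \<in> F" for h
  proof (rule exponential)
    show "germ_comp exp h \<in> L" using exp F(2) that by blast
    show "\<partial> h \<in> F" using that by (rule F.deriv_mem)
    show "\<partial> (germ_comp exp h) = germ_comp exp h * \<partial> h"
      using smooth_differentiable F.smoothI[OF that] by (intro germ_deriv_exp) blast
  qed
  moreover have "\<exists>g\<in>F. g \<in> Cn 1 \<and> \<partial> g = h" if "h \<in> F" for h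
  proof -
    have "h \<in> L" using that F(2) by blast
    then obtain g where "g \<in> L" "g \<in> Cn 1" "\<partial> g = h" using integral by blast
    with primitive that show ?thesis by blast
  qed
  ultimately have "Liouville_closed F"
    using F unfolding Liouville_closed_def hardy_field_iff by blast
  then have "L \<subseteq> F" using least HF by blast
  moreover have "w\<^sup>2 \<in> L" using w_mem power_mem by blast
  ultimately show False using nF by blast
qed

end

lemma inverse_amplitude:
  assumes "q > 0" "v > 0" "q * v\<^sup>2 = (1 :: germ)"
  shows "germ_comp (\<lambda>x. x powr (-1/2)) q = v"
proof -
  have pw: "a powr (-1/2) = b" if "a > 0" "b > 0" "a * b\<^sup>2 = 1" for a b :: real
  proof -
    have "a = (1 / b)\<^sup>2" using that by (simp add: field_simps)
    then have "a powr (-1/2) = ((1 / b) powr 2) powr (-1/2)"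
      using that by simp
    also have "\<dots> = b" using that(2) by (simp add: powr_powr powr_minus)
    finally show ?thesis .
  qed
  show ?thesis
    using assms unfolding power2_eq_square
  proof transfer
    fix q v :: "real \<Rightarrow> real"
    assume "\<forall>\<^sub>F t in at_top. 0 < q t" "\<forall>\<^sub>F t in at_top. 0 < v t"
      "\<forall>\<^sub>F t in at_top. q t * (v t * v t) = 1"
    then show "\<forall>\<^sub>F t in at_top. q t powr (-1/2) = v t"
      by eventually_elim (rule pw[unfolded power2_eq_square])
  qed
qed

lemma sqrt_square_germ:
  fixes q :: germ
  assumes "q > 0"
  shows "q\<^sup>2 > 0 \<and> q = germ_comp sqrt (q\<^sup>2)"
proof
  show "q\<^sup>2 > 0"
    using assms unfolding power2_eq_square by transfer (auto elim: eventually_mono)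
  show "q = germ_comp sqrt (q\<^sup>2)"
    using assms unfolding power2_eq_square by transfer (auto elim: eventually_mono)
qed

text \<open>
  Since \<open>\<phi>' v\<^sup>2\<close> is constant, the first-order terms cancel in
  \<open>(v cos \<phi>)'' + f v cos \<phi> = E cos \<phi>\<close> with \<open>E = v'' - v \<phi>'\<^sup>2 + f v\<close>, and likewise for the sine. The
  cosine and the sine have no common zero, so \<open>E = 0\<close>.
\<close>
lemma pinney_of_solutions:
  assumes L: "hardy_field L" "\<phi> \<in> L" "f \<in> L" "v \<in> L" and v: "\<partial> \<phi> * v\<^sup>2 = 1"
    and sol: "solution f (v * germ_comp cos \<phi>)" "solution f (v * germ_comp sin \<phi>)"
  shows "2 * v\<^sup>2 * \<partial> (\<partial> (v\<^sup>2)) - (\<partial> (v\<^sup>2))\<^sup>2 + 4 * f * (v\<^sup>2)\<^sup>2 = 4"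
proof -
  interpret hardy_field L by fact
  define p C S where "p = \<partial> \<phi>" and "C = germ_comp cos \<phi>" and "S = germ_comp sin \<phi>"
  have mem: "p \<in> L" "\<partial> p \<in> L" "\<partial> v \<in> L" "\<partial> (\<partial> v) \<in> L"
    using L deriv_mem by (simp_all add: p_def)
  have smoothC: "C \<in> C_less_infty" "S \<in> C_less_infty"
    unfolding C_def S_def by (intro smooth_cos_sin smoothI L)+
  have dC: "\<partial> C = - (S * p)" "\<partial> S = C * p"
    unfolding C_def S_def p_def
    using smooth_differentiable[OF smoothI[OF L(2)]] by (simp_all add: germ_deriv_cos germ_deriv_sin)
  note sm = smoothC smoothI[OF L(4)] mem[THEN smoothI] smoothI[OF L(3)]
  have pv: "p * v * v = 1" using v by (simp add: p_def power2_eq_square mult.assoc)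
  have "\<partial> (p * v * v) = 0" unfolding pv by simp
  then have "v * (\<partial> p * v + 2 * p * \<partial> v) = 0"
    using L(4) mem by (simp add: deriv_mult closed_deriv algebra_simps)
  moreover have "v \<noteq> 0" using pv by auto
  ultimately have pv': "\<partial> p * v + 2 * p * \<partial> v = 0"
    using cancel[OF L(4), of "\<partial> p * v + 2 * p * \<partial> v" 0] by simp
  define E where "E = \<partial> (\<partial> v) - v * p * p + f * v"
  have "\<partial> (\<partial> (v * C)) + f * (v * C) = E * C - S * (\<partial> p * v + 2 * p * \<partial> v)"
    by (simp add: E_def smooth_deriv_mult smooth_deriv_add smooth_deriv_diff smooth_deriv_uminus sm
        smooth_closed dC algebra_simps)
  then have "E * C = 0" using sol(1) unfolding solution_def C_def[symmetric] pv' by simp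
  moreover have "\<partial> (\<partial> (v * S)) + f * (v * S) = E * S + C * (\<partial> p * v + 2 * p * \<partial> v)"
    by (simp add: E_def smooth_deriv_mult smooth_deriv_add smooth_deriv_diff smooth_deriv_uminus sm
        smooth_closed dC algebra_simps)
  then have "E * S = 0" using sol(2) unfolding solution_def S_def[symmetric] pv' by simp
  moreover have "C * C + S * S = 1"
    unfolding C_def S_def by transfer (simp add: power2_eq_square[symmetric])
  then have "E = (E * C) * C + (E * S) * S" by (metis distrib_left mult.assoc mult_1_right)
  ultimately have "E = 0" by simp
  have d1: "\<partial> (v\<^sup>2) = 2 * v * \<partial> v"
    using L(4) by (simp add: power2_eq_square deriv_mult)
  have d2: "\<partial> (2 * v * \<partial> v) = 2 * \<partial> v * \<partial> v + 2 * v * \<partial> (\<partial> v)"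
    using L(4) by (simp add: deriv_mult closed_deriv)
  have "2 * v\<^sup>2 * \<partial> (\<partial> (v\<^sup>2)) - (\<partial> (v\<^sup>2))\<^sup>2 + 4 * f * (v\<^sup>2)\<^sup>2
      = 4 * v * v * v * E + 4 * (p * v * v) * (p * v * v)"
    unfolding d1 d2 E_def by (simp add: power2_eq_square algebra_simps)
  then show ?thesis unfolding \<open>E = 0\<close> pv by simp
qed

theorem corollary3:
  fixes f \<phi> :: germ and H L :: "germ set"
  assumes "hardian f"
    and "differentially_algebraic f"
    and "generates_oscillation f"
    and "H = real_diff_field f"
    and "hardian_over H \<phi>"
    and "\<forall>c::real. of_real c < \<phi>"
    and "\<forall>y\<in>Cn 2. solution f y \<longleftrightarrow>
           (\<exists>c d :: real. y = of_real c * germ_comp (\<lambda>x. x powr (-1/2)) (germ_deriv \<phi>) *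
                              germ_comp cos (\<phi> + of_real d))"
    and "smallest_Liouville_closed_ext H L"
    and "\<phi> \<in> L"
  shows "\<exists>h\<in>H. h > 0 \<and> germ_deriv \<phi> = germ_comp sqrt h"
proof -
  have LC: "Liouville_closed L" and HL: "H \<subseteq> L"
    using assms(8) unfolding smallest_Liouville_closed_ext_def by blast+
  then have L: "hardy_field L" "\<real> \<subseteq> L" and RC: "real_closed L"
    unfolding Liouville_closed_def hardy_field_iff by blast+
  interpret L: hardy_field L by fact
  have H: "hardy_field H" "\<real> \<subseteq> H" "f \<in> H"
    using real_diff_field_hardy[OF L(1)] HL assms(4) by auto
  interpret H: hardy_field H by fact
  have inf: "of_real c < \<phi>" for c using assms(6) by blast
  define p where "p = \<partial> \<phi>"
  have p: "p > 0" "p \<in> L"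
    using deriv_pos_of_infinite[OF L(1) assms(9) inf] L.deriv_mem[OF assms(9)] by (simp_all add: p_def)
  then have "p \<noteq> 0" by (auto simp: germ_less_irrefl)
  then obtain w where w: "w \<in> L" "p * w = 1" using L.inverse_mem p(2) by blast
  have "w > 0"
    using p(1) w(2)
  proof transfer
    fix p w :: "real \<Rightarrow> real"
    assume "\<forall>\<^sub>F t in at_top. 0 < p t" "\<forall>\<^sub>F t in at_top. p t * w t = 1"
    then show "\<forall>\<^sub>F t in at_top. 0 < w t"
      by eventually_elim (metis zero_less_mult_pos zero_less_one)
  qed
  then obtain u where u: "u \<in> L" "u\<^sup>2 = w" using RC w(1) unfolding real_closed_def by blast
  have "u \<noteq> 0" using u(2) w(2) by auto
  define v where "v = (if u > 0 then u else - u)"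
  have v: "v \<in> L" "v > 0" "v\<^sup>2 = w"
    using u L.uminus_mem L.pos_or_neg[OF u(1) \<open>u \<noteq> 0\<close>] germ_neg_pos by (auto simp: v_def)
  have amplitude: "germ_comp (\<lambda>x. x powr (-1/2)) (\<partial> \<phi>) = v"
    using inverse_amplitude[OF p(1) v(2)] v(3) w(2) by (simp add: p_def)
  have sol: "solution f (v * germ_comp cos (\<phi> + of_real d))" for d
  proof -
    have "\<phi> + of_real d \<in> L" using assms(9) L(2) Reals_of_real by (intro L.add_mem) auto
    then have "v * germ_comp cos (\<phi> + of_real d) \<in> C_less_infty"
      by (intro smooth_mult smooth_cos_sin L.smoothI v(1))
    then have "v * germ_comp cos (\<phi> + of_real d) \<in> Cn 2" by (simp add: C_less_infty_def)
    moreover have "v * germ_comp cos (\<phi> + of_real d) =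
        of_real 1 * germ_comp (\<lambda>x. x powr (-1/2)) (\<partial> \<phi>) * germ_comp cos (\<phi> + of_real d)"
      unfolding amplitude by simp
    ultimately show ?thesis using assms(7) by blast
  qed
  have "germ_comp cos (\<phi> + of_real (- pi / 2)) = germ_comp sin \<phi>"
    unfolding of_real_germ by transfer (simp add: cos_diff)
  with sol[of "- pi / 2"] sol[of 0]
  have "solution f (v * germ_comp cos \<phi>)" "solution f (v * germ_comp sin \<phi>)" by simp_all
  then have pinney: "2 * w * \<partial> (\<partial> w) - (\<partial> w)\<^sup>2 + 4 * f * w\<^sup>2 = 4"
    using pinney_of_solutions[OF L(1) assms(9) _ v(1)] v(3) w(2) H(3) HL by (auto simp: p_def)
  interpret phase L \<phi> f w
    using L(2) assms(9) H(3) HL w inf pinney by unfold_locales (auto simp: p_def)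
  have w2: "w\<^sup>2 \<in> H" by (rule square_mem_base[OF assms(8) H])
  have pw2: "p\<^sup>2 * w\<^sup>2 = 1" using w(2) by (simp flip: power_mult_distrib)
  then have "w\<^sup>2 \<noteq> 0" by auto
  have "p\<^sup>2 \<in> H" by (rule H.quotient_mem[OF pw2 H.one_mem w2]) fact
  then show ?thesis
    using sqrt_square_germ[OF p(1)] unfolding p_def by (intro bexI[of _ "(\<partial> \<phi>)\<^sup>2"]) simp_all
qed

end
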